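(* Let $G$ be a subgroup of a finite group $X$, and $M\subset X$ a set of coset representatives containing the identity $e$, with unique right inverses for the induced binary operation. Then the algebra $A_{\bowtie}$, with $\star:A_{\bowtie}\to\overline{A_{\bowtie}}$ given by $$\star(\delta_s\otimes u)=\overline{(\delta_s\otimes u)^*},\qquad (\delta_s\otimes u)^*=\big(\delta_{s\triangleleft u}\otimes u^{-1}\tau(a,a^R)\big)\bar\triangleleft\,\tau(a,a^R)^{-1},\qquad a=\langle\delta_s\otimes u\rangle$$ (extended antilinearly in the entry of $\overline{\ \cdot\ }$, so that $\star$ is linear into $\overline{A_{\bowtie}}$), is a star algebra in the bar category $\mathcal C_{\bowtie}$.
   Context: Coset data: every $x\in X$ factors uniquely as $x=us$ with $u\in G$, $s\in M$; $e\in M$. For $s,t\in M$, $u\in G$ define $\tau(s,t)\in G$, $s\cdot t\in M$ by $st=\tau(s,t)(s\cdot t)$, and $s\triangleright u\in G$, $s\triangleleft u\in M$ by $su=(s\triangleright u)(s\triangleleft u)$. Then $e$ is a two-sided identity for $\cdot$ and each $t$ has a unique left inverse $t^L$ ($t^L\cdot t=e$); it is assumed that each $t$ has a unique right inverse $t^R$ ($t\cdot t^R=e$). Category $\mathcal C_{\bowtie}$: objects are finite-dimensional complex vector spaces $V=\oplus_{p\in M}V_p$, with a right action $\bar\triangleleft$ of $G$ such that $\langle\xi\bar\triangleleft u\rangle=\langle\xi\rangle\triangleleft u$, where $\langle\xi\rangle$ is the grade of a homogeneous $\xi$; morphisms are linear maps preserving grade and action. Tensor product: $\langle\xi\otimes\eta\rangle=\langle\xi\rangle\cdot\langle\eta\rangle$,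 $(\xi\otimes\eta)\bar\triangleleft u=\xi\bar\triangleleft(\langle\eta\rangle\triangleright u)\otimes\eta\bar\triangleleft u$; unit $\mathbb C$ with trivial action and grade $e$; associator $\Phi((\xi\otimes\eta)\otimes\zeta)=\xi\bar\triangleleft\tau(\langle\eta\rangle,\langle\zeta\rangle)\otimes(\eta\otimes\zeta)$. Bar structure on $\mathcal C_{\bowtie}$: $\overline V$ is the conjugate vector space (same abelian group, elements written $\overline v$, $\lambda\overline v=\overline{\overline\lambda v}$) with $\langle\overline v\rangle=\langle v\rangle^R$, $\overline v\bar\triangleleft u=\overline{v\bar\triangleleft(\langle v\rangle^R\triangleright u)}$; $\overline\theta(\overline v)=\overline{\theta(v)}$; $\mathrm{bb}_V(v)=\overline{\overline{v\bar\triangleleft\tau(\langle v\rangle^L,\langle v\rangle)^{-1}}}$; $\Upsilon_{W,V}:\overline{W\otimes V}\to\overline V\otimes\overline W$ has inverse $$\Upsilon^{-1}_{W,V}(\overline v\otimes\overline w)=\overline{\big(w\bar\triangleleft\tau(\langle v\rangle,\langle v\rangle^R)^{-1}\otimes v\big)\bar\triangleleft\,\tau(\langle v\rangle^R,\langle w\rangle^R)};$$ $\star:\mathbb C\to\overline{\mathbb C}$ is complex conjugation. Algebra $A_{\bowtie}$: basis $\delta_s\otimes u$ ($s\in M$, $u\in G$). The grade $a=\langle\delta_s\otimes u\rangle\in M$ is the unique solution of $s\cdot a=s\triangleleft u$ (assumed to exist uniquely), and the action is $(\delta_s\otimes u)\bar\triangleleft v=\delta_{s\triangleleft(a\triangleright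 v)}\otimes(a\triangleright v)^{-1}uv$. The product is $$(\delta_s\otimes u)(\delta_t\otimes v)=\delta_{t,s\triangleleft u}\,\delta_{s\triangleleft\tau(a,b)}\otimes\tau(a,b)^{-1}uv,\quad a=\langle\delta_s\otimes u\rangle,\ b=\langle\delta_t\otimes v\rangle,$$ with unit $I=\sum_t\delta_t\otimes e$. A star algebra in a bar category is an object $B$ with associative (with respect to $\Phi$) product $\mu:B\otimes B\to B$ and unit $\eta:1\to B$, and a morphism $\star_B:B\to\overline B$ with $\overline{\star_B}\,\star_B=\mathrm{bb}_B$, $\overline\mu\,\Upsilon^{-1}_{B,B}(\star_B\otimes\star_B)=\star_B\,\mu$, $\overline\eta\,\star=\star_B\,\eta$. *)

theory Defs
  imports Complex_Main "HOL-Library.FuncSet" "HOL-Library.Function_Algebras" "HOL-Algebra.Group"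
begin

section \<open>Complex vector spaces, linear maps, tensor products\<close>

text \<open>
  A space is a subspace \<open>vecs V\<close> of an ambient type carrying a scalar multiplication. Addition is that
  of the type, while the scalar multiplication is part of the data, so that the conjugate
  space can be formed on the same abelian group.
\<close>

record 'v cspace =
  vecs :: "'v set"
  scl :: "complex \<Rightarrow> 'v \<Rightarrow> 'v"

definition fin_dim_cspace :: "('v::ab_group_add, 'm) cspace_scheme \<Rightarrow> bool" where
  "fin_dim_cspace V \<longleftrightarrow>
     vector_space (scl V) \<and> module.subspace (scl V) (vecs V) \<and>
     (\<exists>B. finite B \<and> B \<subseteq> vecs V \<and> module.span (scl V) B = vecs V)"

definition linear_map ::
  "('v::ab_group_add, 'm) cspace_scheme \<Rightarrow> ('w::ab_group_add, 'n) cspace_scheme \<Rightarrow> ('v \<Rightarrow> 'w) \<Rightarrow> bool"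
  where
  "linear_map V W f \<longleftrightarrow>
     f \<in> vecs V \<rightarrow> vecs W \<and>
     (\<forall>x\<in>vecs V. \<forall>y\<in>vecs V. f (x + y) = f x + f y) \<and>
     (\<forall>c. \<forall>x\<in>vecs V. f (scl V c x) = scl W c (f x))"

text \<open>
  The linear map \<open>V \<rightarrow> W\<close> determined by a condition \<open>P\<close>, which in all uses below prescribes its values
  on a spanning set. Linear maps are normalised to be \<open>undefined\<close> outside \<open>vecs V\<close>, so that equality
  of maps is equality of HOL functions.
\<close>

definition the_linear_map ::
  "('v::ab_group_add, 'm) cspace_scheme \<Rightarrow> ('w::ab_group_add, 'n) cspace_scheme \<Rightarrow>
     (('v \<Rightarrow> 'w) \<Rightarrow> bool) \<Rightarrow> 'v \<Rightarrow> 'w" where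
  "the_linear_map V W P = (THE h. linear_map V W h \<and> h \<in> extensional (vecs V) \<and> P h)"

definition bilinear_form ::
  "('v::ab_group_add, 'm) cspace_scheme \<Rightarrow> ('w::ab_group_add, 'n) cspace_scheme \<Rightarrow>
     ('v \<Rightarrow> 'w \<Rightarrow> complex) \<Rightarrow> bool" where
  "bilinear_form V W \<beta> \<longleftrightarrow>
     (\<forall>x\<in>vecs V. \<forall>y\<in>vecs V. \<forall>w\<in>vecs W. \<beta> (x + y) w = \<beta> x w + \<beta> y w) \<and>
     (\<forall>x\<in>vecs V. \<forall>w\<in>vecs W. \<forall>z\<in>vecs W. \<beta> x (w + z) = \<beta> x w + \<beta> x z) \<and>
     (\<forall>c. \<forall>x\<in>vecs V. \<forall>w\<in>vecs W. \<beta> (scl V c x) w = c * \<beta> x w) \<and>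
     (\<forall>c. \<forall>x\<in>vecs V. \<forall>w\<in>vecs W. \<beta> x (scl W c w) = c * \<beta> x w)"

text \<open>
  The tensor product is realised inside the functionals on bilinear forms: \<open>v \<otimes> w\<close> is evaluation at
  \<open>(v, w)\<close>. Since bilinear forms separate the elements of the algebraic tensor product, the span
  of the pure tensors has the universal property.
\<close>

type_synonym ('v, 'w) tens = "('v \<Rightarrow> 'w \<Rightarrow> complex) \<Rightarrow> complex"

definition ptens ::
  "('v::ab_group_add, 'm) cspace_scheme \<Rightarrow> ('w::ab_group_add, 'n) cspace_scheme \<Rightarrow>
     'v \<Rightarrow> 'w \<Rightarrow> ('v, 'w) tens" where
  "ptens V W v w = (\<lambda>\<beta>. if bilinear_form V W \<beta> then \<beta> v w else 0)"

definition fun_scale :: "complex \<Rightarrow> ('b \<Rightarrow> complex) \<Rightarrow> 'b \<Rightarrow> complex" where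
  "fun_scale c f = (\<lambda>x. c * f x)"

definition tensor_space ::
  "('v::ab_group_add, 'm) cspace_scheme \<Rightarrow> ('w::ab_group_add, 'n) cspace_scheme \<Rightarrow>
     ('v, 'w) tens cspace" where
  "tensor_space V W =
     \<lparr>vecs = module.span fun_scale {ptens V W v w | v w. v \<in> vecs V \<and> w \<in> vecs W},
      scl = fun_scale\<rparr>"

definition tensor_map ::
  "('v::ab_group_add, 'm) cspace_scheme \<Rightarrow> ('v'::ab_group_add, 'm') cspace_scheme \<Rightarrow>
   ('w::ab_group_add, 'n) cspace_scheme \<Rightarrow> ('w'::ab_group_add, 'n') cspace_scheme \<Rightarrow>
   ('v \<Rightarrow> 'v') \<Rightarrow> ('w \<Rightarrow> 'w') \<Rightarrow> ('v, 'w) tens \<Rightarrow> ('v', 'w') tens" where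
  "tensor_map V V' W W' f g =
     the_linear_map (tensor_space V W) (tensor_space V' W')
       (\<lambda>h. \<forall>v\<in>vecs V. \<forall>w\<in>vecs W. h (ptens V W v w) = ptens V' W' (f v) (g w))"

definition id_map :: "('v, 'm) cspace_scheme \<Rightarrow> 'v \<Rightarrow> 'v" where
  "id_map V = (\<lambda>v\<in>vecs V. v)"


section \<open>Coset data\<close>

text \<open>
  The locale only fixes the parameters, so the definitions below are unconditional; they are
  meaningful when every element of \<open>X\<close> factors uniquely as \<open>u \<otimes> s\<close> with \<open>u \<in> G\<close> and \<open>s \<in> M\<close>.
\<close>

locale coset_data =
  fixes X :: "('x, 'k) monoid_scheme" (structure)
    and G :: "'x set" and M :: "'x set"
begin

definition gpart :: "'x \<Rightarrow> 'x" where
  "gpart x = (THE u. u \<in> G \<and> (\<exists>s\<in>M. x = u \<otimes> s))"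

definition mpart :: "'x \<Rightarrow> 'x" where
  "mpart x = (THE s. s \<in> M \<and> (\<exists>u\<in>G. x = u \<otimes> s))"

definition tau :: "'x \<Rightarrow> 'x \<Rightarrow> 'x" where
  "tau s t = gpart (s \<otimes> t)"

definition mdot :: "'x \<Rightarrow> 'x \<Rightarrow> 'x"  (infixl \<open>\<odot>\<close> 70) where
  "s \<odot> t = mpart (s \<otimes> t)"

definition gact :: "'x \<Rightarrow> 'x \<Rightarrow> 'x"  (infixl \<open>\<rhd>\<close> 72) where
  "s \<rhd> u = gpart (s \<otimes> u)"

definition mact :: "'x \<Rightarrow> 'x \<Rightarrow> 'x"  (infixl \<open>\<lhd>\<^sub>M\<close> 72) where
  "s \<lhd>\<^sub>M u = mpart (s \<otimes> u)"

definition linv :: "'x \<Rightarrow> 'x" where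
  "linv t = (THE r. r \<in> M \<and> r \<odot> t = \<one>)"

definition rinv :: "'x \<Rightarrow> 'x" where
  "rinv t = (THE r. r \<in> M \<and> t \<odot> r = \<one>)"

end


section \<open>The category of graded spaces with action\<close>

record ('x, 'v) gspace = "'v cspace" +
  grad :: "'x \<Rightarrow> 'v set"
  act :: "'v \<Rightarrow> 'x \<Rightarrow> 'v"

context coset_data
begin

definition is_object :: "('x, 'v::ab_group_add) gspace \<Rightarrow> bool" where
  "is_object V \<longleftrightarrow>
     fin_dim_cspace V \<and>
     (\<forall>p\<in>M. module.subspace (scl V) (grad V p) \<and> grad V p \<subseteq> vecs V) \<and>
     (\<forall>v\<in>vecs V. \<exists>!f. f \<in> (\<Pi>\<^sub>E p\<in>M. grad V p) \<and> v = (\<Sum>p\<in>M. f p)) \<and>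
     (\<forall>u\<in>G. linear_map V V (\<lambda>v. act V v u)) \<and>
     (\<forall>v\<in>vecs V. act V v \<one> = v) \<and>
     (\<forall>u\<in>G. \<forall>w\<in>G. \<forall>v\<in>vecs V. act V v (u \<otimes> w) = act V (act V v u) w) \<and>
     (\<forall>p\<in>M. \<forall>u\<in>G. \<forall>v\<in>grad V p. act V v u \<in> grad V (p \<lhd>\<^sub>M u))"

definition hom_set ::
  "('x, 'v::ab_group_add) gspace \<Rightarrow> ('x, 'w::ab_group_add) gspace \<Rightarrow> ('v \<Rightarrow> 'w) set" where
  "hom_set V W =
     {f. f \<in> extensional (vecs V) \<and> linear_map V W f \<and>
         (\<forall>p\<in>M. \<forall>v\<in>grad V p. f v \<in> grad W p) \<and>
         (\<forall>u\<in>G. \<forall>v\<in>vecs V. f (act V v u) = act W (f v) u)}"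

definition tensor ::
  "('x, 'v::ab_group_add) gspace \<Rightarrow> ('x, 'w::ab_group_add) gspace \<Rightarrow> ('x, ('v, 'w) tens) gspace" where
  "tensor V W =
     \<lparr>vecs = vecs (tensor_space V W),
      scl = scl (tensor_space V W),
      grad = (\<lambda>r. module.span fun_scale
                {ptens V W \<xi> \<eta> | \<xi> \<eta> p q. p \<in> M \<and> q \<in> M \<and> p \<odot> q = r \<and> \<xi> \<in> grad V p \<and> \<eta> \<in> grad W q}),
      act = (\<lambda>t u. the_linear_map (tensor_space V W) (tensor_space V W)
                (\<lambda>h. \<forall>q\<in>M. \<forall>\<xi>\<in>vecs V. \<forall>\<eta>\<in>grad W q.
                   h (ptens V W \<xi> \<eta>) = ptens V W (act V \<xi> (q \<rhd> u)) (act W \<eta> u)) t)\<rparr>"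

definition unit_object :: "('x, complex) gspace" where
  "unit_object =
     \<lparr>vecs = UNIV, scl = (*), grad = (\<lambda>p. if p = \<one> then UNIV else {0}), act = (\<lambda>z u. z)\<rparr>"

definition associator ::
  "('x, 'v::ab_group_add) gspace \<Rightarrow> ('x, 'w::ab_group_add) gspace \<Rightarrow> ('x, 'z::ab_group_add) gspace \<Rightarrow>
     (('v, 'w) tens, 'z) tens \<Rightarrow> ('v, ('w, 'z) tens) tens" where
  "associator V W Z =
     the_linear_map (tensor (tensor V W) Z) (tensor V (tensor W Z))
       (\<lambda>h. \<forall>q\<in>M. \<forall>r\<in>M. \<forall>\<xi>\<in>vecs V. \<forall>\<eta>\<in>grad W q. \<forall>\<zeta>\<in>grad Z r.
          h (ptens (tensor V W) Z (ptens V W \<xi> \<eta>) \<zeta>) =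
            ptens V (tensor W Z) (act V \<xi> (tau q r)) (ptens W Z \<eta> \<zeta>))"

definition left_unitor :: "('x, 'v::ab_group_add) gspace \<Rightarrow> (complex, 'v) tens \<Rightarrow> 'v" where
  "left_unitor V = the_linear_map (tensor unit_object V) V
     (\<lambda>h. \<forall>z. \<forall>v\<in>vecs V. h (ptens unit_object V z v) = scl V z v)"

definition right_unitor :: "('x, 'v::ab_group_add) gspace \<Rightarrow> ('v, complex) tens \<Rightarrow> 'v" where
  "right_unitor V = the_linear_map (tensor V unit_object) V
     (\<lambda>h. \<forall>z. \<forall>v\<in>vecs V. h (ptens V unit_object v z) = scl V z v)"


subsection \<open>The bar structure\<close>

text \<open>
  The element \<open>v\<close>-bar of the conjugate space is represented by \<open>v\<close> itself, so the bar of a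
  morphism is the same underlying function.
\<close>

definition bar :: "('x, 'v::ab_group_add) gspace \<Rightarrow> ('x, 'v) gspace" where
  "bar V =
     \<lparr>vecs = vecs V,
      scl = (\<lambda>c v. scl V (cnj c) v),
      grad = (\<lambda>r. {v. \<exists>p\<in>M. rinv p = r \<and> v \<in> grad V p}),
      act = (\<lambda>v u. the_linear_map V V
                (\<lambda>h. \<forall>p\<in>M. \<forall>x\<in>grad V p. h x = act V x (rinv p \<rhd> u)) v)\<rparr>"

definition bar_map :: "('v \<Rightarrow> 'w) \<Rightarrow> 'v \<Rightarrow> 'w" where
  "bar_map \<theta> = \<theta>"

definition bb :: "('x, 'v::ab_group_add) gspace \<Rightarrow> 'v \<Rightarrow> 'v" where
  "bb V = the_linear_map V (bar (bar V))
     (\<lambda>h. \<forall>p\<in>M. \<forall>v\<in>grad V p. h v = act V v (inv (tau (linv p) p)))"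

text \<open>The inverse of \<open>\<Upsilon>\<close> at \<open>(W, V)\<close>, a map from \<open>bar V \<otimes> bar W\<close> to \<open>bar (W \<otimes> V)\<close>.\<close>

definition upsilon_inv ::
  "('x, 'w::ab_group_add) gspace \<Rightarrow> ('x, 'v::ab_group_add) gspace \<Rightarrow> ('v, 'w) tens \<Rightarrow> ('w, 'v) tens" where
  "upsilon_inv W V =
     the_linear_map (tensor (bar V) (bar W)) (bar (tensor W V))
       (\<lambda>h. \<forall>p\<in>M. \<forall>q\<in>M. \<forall>v\<in>grad V p. \<forall>w\<in>grad W q.
          h (ptens (bar V) (bar W) v w) =
            act (tensor W V) (ptens W V (act W w (inv (tau p (rinv p)))) v) (tau (rinv p) (rinv q)))"

definition unit_star :: "complex \<Rightarrow> complex" where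
  "unit_star = cnj"


subsection \<open>Star algebras\<close>

definition is_algebra ::
  "('x, 'v::ab_group_add) gspace \<Rightarrow> (('v, 'v) tens \<Rightarrow> 'v) \<Rightarrow> (complex \<Rightarrow> 'v) \<Rightarrow> bool" where
  "is_algebra B \<mu> \<eta> \<longleftrightarrow>
     is_object B \<and>
     \<mu> \<in> hom_set (tensor B B) B \<and>
     \<eta> \<in> hom_set unit_object B \<and>
     compose (vecs (tensor (tensor B B) B)) \<mu> (tensor_map (tensor B B) B B B \<mu> (id_map B)) =
       compose (vecs (tensor (tensor B B) B)) \<mu>
         (compose (vecs (tensor (tensor B B) B))
           (tensor_map B B (tensor B B) B (id_map B) \<mu>) (associator B B B)) \<and>
     compose (vecs (tensor unit_object B)) \<mu> (tensor_map unit_object B B B \<eta> (id_map B)) =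
       left_unitor B \<and>
     compose (vecs (tensor B unit_object)) \<mu> (tensor_map B B unit_object B (id_map B) \<eta>) =
       right_unitor B"

definition is_star_algebra ::
  "('x, 'v::ab_group_add) gspace \<Rightarrow> (('v, 'v) tens \<Rightarrow> 'v) \<Rightarrow> (complex \<Rightarrow> 'v) \<Rightarrow> ('v \<Rightarrow> 'v) \<Rightarrow> bool" where
  "is_star_algebra B \<mu> \<eta> st \<longleftrightarrow>
     is_algebra B \<mu> \<eta> \<and>
     st \<in> hom_set B (bar B) \<and>
     compose (vecs B) (bar_map st) st = bb B \<and>
     compose (vecs (tensor B B)) (bar_map \<mu>)
         (compose (vecs (tensor B B)) (upsilon_inv B B) (tensor_map B (bar B) B (bar B) st st)) =
       compose (vecs (tensor B B)) st \<mu> \<and>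
     compose (vecs unit_object) (bar_map \<eta>) unit_star = compose (vecs unit_object) st \<eta>"


section \<open>The algebra on the basis \<open>\<delta>\<^sub>s \<otimes> u\<close>\<close>

text \<open>Vectors are represented by their coordinate functions, supported on \<open>M \<times> G\<close>.\<close>

definition dlt :: "'x \<Rightarrow> 'x \<Rightarrow> 'x \<times> 'x \<Rightarrow> complex" where
  "dlt s u = (\<lambda>x. if x = (s, u) then 1 else 0)"

definition A_grade :: "'x \<Rightarrow> 'x \<Rightarrow> 'x" where
  "A_grade s u = (THE a. a \<in> M \<and> s \<odot> a = s \<lhd>\<^sub>M u)"

definition A_space :: "('x \<times> 'x \<Rightarrow> complex) cspace" where
  "A_space = \<lparr>vecs = {f. \<forall>x. x \<notin> M \<times> G \<longrightarrow> f x = 0}, scl = fun_scale\<rparr>"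

definition A_bowtie :: "('x, 'x \<times> 'x \<Rightarrow> complex) gspace" where
  "A_bowtie =
     \<lparr>vecs = vecs A_space,
      scl = scl A_space,
      grad = (\<lambda>p. module.span fun_scale {dlt s u | s u. s \<in> M \<and> u \<in> G \<and> A_grade s u = p}),
      act = (\<lambda>f v. the_linear_map A_space A_space
                (\<lambda>h. \<forall>s\<in>M. \<forall>u\<in>G. h (dlt s u) =
                   (let g = A_grade s u \<rhd> v in dlt (s \<lhd>\<^sub>M g) (inv g \<otimes> u \<otimes> v))) f)\<rparr>"

definition A_mult :: "('x \<times> 'x \<Rightarrow> complex, 'x \<times> 'x \<Rightarrow> complex) tens \<Rightarrow> 'x \<times> 'x \<Rightarrow> complex" where
  "A_mult = the_linear_map (tensor A_bowtie A_bowtie) A_bowtie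
     (\<lambda>h. \<forall>s\<in>M. \<forall>u\<in>G. \<forall>t\<in>M. \<forall>v\<in>G. h (ptens A_bowtie A_bowtie (dlt s u) (dlt t v)) =
        (let g = tau (A_grade s u) (A_grade t v)
         in if t = s \<lhd>\<^sub>M u then dlt (s \<lhd>\<^sub>M g) (inv g \<otimes> u \<otimes> v) else 0))"

definition A_unit :: "complex \<Rightarrow> 'x \<times> 'x \<Rightarrow> complex" where
  "A_unit = (\<lambda>z. scl A_bowtie z (\<Sum>t\<in>M. dlt t \<one>))"

definition A_star :: "('x \<times> 'x \<Rightarrow> complex) \<Rightarrow> 'x \<times> 'x \<Rightarrow> complex" where
  "A_star = the_linear_map A_bowtie (bar A_bowtie)
     (\<lambda>h. \<forall>s\<in>M. \<forall>u\<in>G. h (dlt s u) =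
        (let g = tau (A_grade s u) (rinv (A_grade s u))
         in act A_bowtie (dlt (s \<lhd>\<^sub>M u) (inv u \<otimes> g)) (inv g)))"

end

end

theory Submission
  imports Defs
begin

text \<open>
  The assignment \<open>(s, x) \<mapsto> mpart (s \<otimes> x)\<close> is a right action of the whole group \<open>X\<close> on \<open>M\<close>, which
  extends both \<open>\<lhd>\<^sub>M\<close> and \<open>\<odot>\<close>, and all other operations are words in its values. For a basis vector
  \<open>\<delta>\<^sub>s \<otimes> u\<close> of grade \<open>a\<close> the definition of the grade says that \<open>u\<close> and \<open>a\<close> act on \<open>s\<close> in the same way,
  and the involution becomes \<open>(\<delta>\<^sub>s \<otimes> u)* = \<delta>\<^sub>t \<otimes> a\<^sup>L a u\<^sup>-\<^sup>1\<close> with \<open>t\<close> the image of \<open>s\<close> under the inverse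
  of \<open>a\<^sup>L\<close>. Since all structure maps permute bases, up to the value 0 for the product, each axiom
  is a pair of equations between words in \<open>X\<close>.
\<close>

section \<open>Spaces with a finite basis\<close>

text \<open>Two obstacles shape the development. Every structure map is given as the unique linear
  map satisfying a condition on suitable vectors, so nothing can be computed before existence and
  uniqueness are known. Bases therefore come with explicit coordinate functionals, which pass to
  tensor products and conjugates, and each prescription is shown to be equivalent to values on a
  basis. The other obstacle is that the product vanishes on many pairs of basis vectors. An identity
  involving it needs more than equal indices: both sides must also be nonzero for the same
  arguments. Such conditions compare two elements of \<open>M\<close> moved by a common group
  element, which cancels because \<open>X\<close> permutes cosets. The word equations can be settled
  by rewriting because \<open>gpart x\<close> is \<open>x \<otimes> inv mpart x\<close>. Once it is
  eliminated, \<open>mpart\<close> is the only operation outside group theory, and it ignores a left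
  factor from \<open>G\<close> and an \<open>mpart\<close> in leading position.\<close>

definition is_cspace :: "('v::ab_group_add, 'm) cspace_scheme \<Rightarrow> bool" where
  "is_cspace V \<longleftrightarrow> vector_space (scl V) \<and> module.subspace (scl V) (vecs V)"

lemma is_cspace_module: "is_cspace V \<Longrightarrow> module (scl V)"
  by (simp add: is_cspace_def module_iff_vector_space)

lemma is_cspace_closed:
  assumes "is_cspace V"
  shows "0 \<in> vecs V"
    and "x \<in> vecs V \<Longrightarrow> y \<in> vecs V \<Longrightarrow> x + y \<in> vecs V"
    and "x \<in> vecs V \<Longrightarrow> scl V k x \<in> vecs V"
    and "(\<And>i. i \<in> I \<Longrightarrow> f i \<in> vecs V) \<Longrightarrow> sum f I \<in> vecs V"
proof -
  interpret module "scl V" using assms by (rule is_cspace_module)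
  have s: "subspace (vecs V)" using assms by (simp add: is_cspace_def)
  show "0 \<in> vecs V"
    and "x \<in> vecs V \<Longrightarrow> y \<in> vecs V \<Longrightarrow> x + y \<in> vecs V"
    and "x \<in> vecs V \<Longrightarrow> scl V k x \<in> vecs V"
    and "(\<And>i. i \<in> I \<Longrightarrow> f i \<in> vecs V) \<Longrightarrow> sum f I \<in> vecs V"
    using s by (auto intro: subspace_0 subspace_add subspace_scale subspace_sum)
qed

lemma linear_mapI:
  assumes "\<And>x. x \<in> vecs V \<Longrightarrow> f x \<in> vecs W"
    and "\<And>x y. x \<in> vecs V \<Longrightarrow> y \<in> vecs V \<Longrightarrow> f (x + y) = f x + f y"
    and "\<And>c x. x \<in> vecs V \<Longrightarrow> f (scl V c x) = scl W c (f x)"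
  shows "linear_map V W f"
  using assms by (auto simp: linear_map_def)

lemma linear_mapD:
  assumes "linear_map V W f"
  shows "x \<in> vecs V \<Longrightarrow> f x \<in> vecs W"
    and "x \<in> vecs V \<Longrightarrow> y \<in> vecs V \<Longrightarrow> f (x + y) = f x + f y"
    and "x \<in> vecs V \<Longrightarrow> f (scl V c x) = scl W c (f x)"
  using assms by (auto simp: linear_map_def)

lemma linear_map_zero:
  assumes "is_cspace V" "linear_map V W f"
  shows "f 0 = 0"
  using linear_mapD(2)[OF assms(2), of 0 0] is_cspace_closed(1)[OF assms(1)] by simp

lemma linear_map_sum:
  assumes "is_cspace V" "linear_map V W f" "\<And>i. i \<in> I \<Longrightarrow> x i \<in> vecs V"
  shows "f (\<Sum>i\<in>I. x i) = (\<Sum>i\<in>I. f (x i))"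
  using assms(3)
  by (induction I rule: infinite_finite_induct)
    (simp_all add: linear_map_zero[OF assms(1,2)] linear_mapD(2)[OF assms(2)]
      is_cspace_closed[OF assms(1)])

lemma linear_map_comp:
  assumes f: "linear_map U V f" and g: "linear_map V W g"
  shows "linear_map U W (\<lambda>x. g (f x))"
  by (intro linear_mapI) (simp_all add: linear_mapD[OF f] linear_mapD[OF g])

lemma linear_map_id_map: "linear_map V V (id_map V)" if "is_cspace V"
  using is_cspace_closed[OF that] by (intro linear_mapI) (auto simp: id_map_def)

lemma linear_map_restrict:
  assumes "is_cspace V"
  shows "linear_map V W (restrict f (vecs V)) \<longleftrightarrow> linear_map V W f"
  using is_cspace_closed(2,3)[OF assms] by (auto simp: linear_map_def Pi_iff)

lemma linear_map_compose:
  assumes "is_cspace U" "linear_map U V f" "linear_map V W g"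
  shows "linear_map U W (compose (vecs U) g f)"
  using linear_map_comp[OF assms(2,3)] by (simp add: compose_def linear_map_restrict[OF assms(1)])

lemma linear_map_eq_on_span:
  assumes V: "is_cspace V" and f: "linear_map V W f" and g: "linear_map V W g"
    and S: "S \<subseteq> vecs V" and eq: "\<And>x. x \<in> S \<Longrightarrow> f x = g x"
    and x: "x \<in> module.span (scl V) S"
  shows "f x = g x"
proof -
  interpret module "scl V" using V by (rule is_cspace_module)
  have "subspace {x \<in> vecs V. f x = g x}"
    using is_cspace_closed[OF V] linear_mapD[OF f] linear_mapD[OF g]
      linear_map_zero[OF V f] linear_map_zero[OF V g]
    by (auto simp: subspace_def)
  then have "span S \<subseteq> {x \<in> vecs V. f x = g x}"
    using S eq by (intro span_minimal) auto
  then show ?thesis using x by auto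
qed

text \<open>The vectors sent into \<open>U\<close> form a subspace containing \<open>S\<close>. As
  \<open>S\<close> may span just a part of \<open>V\<close>, a single homogeneous component can be
  treated; this is how preservation of grades is checked.\<close>

lemma linear_map_into_span:
  assumes V: "is_cspace V" and f: "linear_map V W f"
    and S: "S \<subseteq> vecs V" and W: "is_cspace W"
    and U: "module.subspace (scl W) U" and im: "\<And>x. x \<in> S \<Longrightarrow> f x \<in> U"
    and x: "x \<in> module.span (scl V) S"
  shows "f x \<in> U"
proof -
  interpret V: module "scl V" using V by (rule is_cspace_module)
  interpret W: module "scl W" using W by (rule is_cspace_module)
  have "V.subspace {x \<in> vecs V. f x \<in> U}"
    using is_cspace_closed[OF V] linear_mapD[OF f] linear_map_zero[OF V f] U
    by (auto simp: V.subspace_def W.subspace_def)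
  then have "V.span S \<subseteq> {x \<in> vecs V. f x \<in> U}"
    using S im by (intro V.span_minimal) auto
  then show ?thesis using x by auto
qed

text \<open>Extend in the first argument with the second fixed in \<open>T\<close>, then in the
  second. \<open>S\<close> and \<open>T\<close> may span proper subspaces: several structure maps
  are prescribed for homogeneous arguments, and then \<open>T\<close> is the part of a basis lying
  in one grade.\<close>

lemma bilinear_eq_on_span:
  assumes V: "is_cspace V" and W: "is_cspace W"
    and S: "S \<subseteq> vecs V" and T: "T \<subseteq> vecs W"
    and F1: "\<And>y. y \<in> vecs W \<Longrightarrow> linear_map V U (\<lambda>x. F x y)"
    and F2: "\<And>x. x \<in> vecs V \<Longrightarrow> linear_map W U (F x)"
    and H1: "\<And>y. y \<in> vecs W \<Longrightarrow> linear_map V U (\<lambda>x. H x y)"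
    and H2: "\<And>x. x \<in> vecs V \<Longrightarrow> linear_map W U (H x)"
    and eq: "\<And>x y. x \<in> S \<Longrightarrow> y \<in> T \<Longrightarrow> F x y = H x y"
    and x: "x \<in> module.span (scl V) S" and y: "y \<in> module.span (scl W) T"
  shows "F x y = H x y"
proof (rule linear_map_eq_on_span[OF W F2 H2 T _ y])
  have "module.span (scl V) S \<subseteq> vecs V"
    using V S by (intro module.span_minimal is_cspace_module) (auto simp: is_cspace_def)
  then show "x \<in> vecs V" "x \<in> vecs V" using x by auto
  show "F x y = H x y" if "y \<in> T" for y
    by (rule linear_map_eq_on_span[OF V F1 H1 S _ x]) (use that T eq in auto)
qed

text \<open>The coordinate functionals \<open>c\<close> are part of the data. Their duality with
  \<open>e\<close> encodes linear independence, and they can be multiplied for tensor products and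
  conjugated for bar spaces.\<close>

definition has_basis ::
  "('v::ab_group_add, 'm) cspace_scheme \<Rightarrow> 'i set \<Rightarrow> ('i \<Rightarrow> 'v) \<Rightarrow> ('v \<Rightarrow> 'i \<Rightarrow> complex) \<Rightarrow> bool" where
  "has_basis V I e c \<longleftrightarrow>
     is_cspace V \<and> finite I \<and> e ` I \<subseteq> vecs V \<and>
     (\<forall>i\<in>I. \<forall>x\<in>vecs V. \<forall>y\<in>vecs V. c (x + y) i = c x i + c y i) \<and>
     (\<forall>i\<in>I. \<forall>x\<in>vecs V. \<forall>k. c (scl V k x) i = k * c x i) \<and>
     (\<forall>i\<in>I. \<forall>j\<in>I. c (e i) j = (if i = j then 1 else 0)) \<and>
     (\<forall>x\<in>vecs V. x = (\<Sum>i\<in>I. scl V (c x i) (e i)))"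

lemma has_basisD:
  assumes "has_basis V I e c"
  shows "is_cspace V" and "finite I" and "e ` I \<subseteq> vecs V"
    and "i \<in> I \<Longrightarrow> e i \<in> vecs V"
    and "i \<in> I \<Longrightarrow> x \<in> vecs V \<Longrightarrow> y \<in> vecs V \<Longrightarrow> c (x + y) i = c x i + c y i"
    and "i \<in> I \<Longrightarrow> x \<in> vecs V \<Longrightarrow> c (scl V k x) i = k * c x i"
    and "i \<in> I \<Longrightarrow> j \<in> I \<Longrightarrow> c (e i) j = (if i = j then 1 else 0)"
    and "x \<in> vecs V \<Longrightarrow> (\<Sum>i\<in>I. scl V (c x i) (e i)) = x"
  using assms by (auto simp: has_basis_def)

lemma has_basis_span:
  assumes "has_basis V I e c"
  shows "module.span (scl V) (e ` I) = vecs V"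
proof -
  note B = has_basisD[OF assms]
  interpret module "scl V" using B(1) by (rule is_cspace_module)
  have "span (e ` I) \<subseteq> vecs V"
    using B(1,3) by (intro span_minimal) (auto simp: is_cspace_def)
  moreover have "x \<in> span (e ` I)" if "x \<in> vecs V" for x
    by (subst B(8)[OF that, symmetric]) (intro span_sum span_scale span_base imageI)
  ultimately show ?thesis by blast
qed

lemma linear_map_eq_on_basis:
  assumes "has_basis V I e c" "linear_map V W f" "linear_map V W g"
    and "\<And>i. i \<in> I \<Longrightarrow> f (e i) = g (e i)" and "x \<in> vecs V"
  shows "f x = g x"
  by (rule linear_map_eq_on_span[of V W f g "e ` I"])
    (use assms has_basis_span[OF assms(1)] has_basisD[OF assms(1)] in auto)

lemma extensional_linear_map_eqI:
  assumes "has_basis V I e c" "linear_map V W f" "linear_map V W g"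
    and "f \<in> extensional (vecs V)" "g \<in> extensional (vecs V)"
    and "\<And>i. i \<in> I \<Longrightarrow> f (e i) = g (e i)"
  shows "f = g"
  using assms(4,5) linear_map_eq_on_basis[OF assms(1-3,6)] by (intro extensionalityI) auto

lemma linear_extension:
  assumes B: "has_basis V I e c" and W: "is_cspace W" and \<phi>: "\<And>i. i \<in> I \<Longrightarrow> \<phi> i \<in> vecs W"
  defines "h \<equiv> (\<lambda>x\<in>vecs V. \<Sum>i\<in>I. scl W (c x i) (\<phi> i))"
  shows "linear_map V W h" and "i \<in> I \<Longrightarrow> h (e i) = \<phi> i"
proof -
  note D = has_basisD[OF B]
  interpret W: module "scl W" using W by (rule is_cspace_module)
  show "linear_map V W h"
    unfolding h_def linear_map_restrict[OF D(1)]
    by (intro linear_mapI)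
      (auto intro!: is_cspace_closed(4)[OF W] is_cspace_closed(3)[OF W] \<phi> sum.cong
        simp: D(5,6) W.scale_left_distrib sum.distrib W.scale_sum_right)
  have "scl W (c (e i) j) (\<phi> j) = (if i = j then \<phi> j else 0)" if "i \<in> I" "j \<in> I" for i j
    using that by (simp add: D(7))
  then show "h (e i) = \<phi> i" if "i \<in> I"
    using that D(2,4) by (simp add: h_def)
qed

text \<open>This makes the definite descriptions computable. The premise on \<open>P\<close> asks
  that, for linear \<open>h\<close>, the prescription amount to values on a basis. Linear extension
  then gives existence, and the convention of being \<open>undefined\<close> off
  \<open>vecs V\<close> makes the function itself unique.\<close>

lemma the_linear_map_basis:
  assumes B: "has_basis V I e c" and W: "is_cspace W" and \<phi>: "\<And>i. i \<in> I \<Longrightarrow> \<phi> i \<in> vecs W"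
    and P: "\<And>h. linear_map V W h \<Longrightarrow> P h \<longleftrightarrow> (\<forall>i\<in>I. h (e i) = \<phi> i)"
  shows "linear_map V W (the_linear_map V W P)"
    and "the_linear_map V W P \<in> extensional (vecs V)"
    and "P (the_linear_map V W P)"
    and "i \<in> I \<Longrightarrow> the_linear_map V W P (e i) = \<phi> i"
proof -
  let ?Q = "\<lambda>h. linear_map V W h \<and> h \<in> extensional (vecs V) \<and> P h"
  note h = linear_extension[OF B W \<phi>]
  have "\<exists>!h. ?Q h"
  proof (rule ex1I)
    show "?Q (\<lambda>x\<in>vecs V. \<Sum>i\<in>I. scl W (c x i) (\<phi> i))"
      using h P[OF h(1)] by simp
    show "f = (\<lambda>x\<in>vecs V. \<Sum>i\<in>I. scl W (c x i) (\<phi> i))" if "?Q f" for f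
      using that P[of f] h by (intro extensional_linear_map_eqI[OF B _ h(1)]) auto
  qed
  then have Q: "?Q (the_linear_map V W P)"
    unfolding the_linear_map_def by (rule theI')
  then show "linear_map V W (the_linear_map V W P)"
    and "the_linear_map V W P \<in> extensional (vecs V)"
    and "P (the_linear_map V W P)"
    and "i \<in> I \<Longrightarrow> the_linear_map V W P (e i) = \<phi> i"
    using P[of "the_linear_map V W P"] by auto
qed


section \<open>Tensor products of spaces with bases\<close>

lemma vector_space_fun_scale: "vector_space fun_scale"
  by unfold_locales (auto simp: fun_scale_def fun_eq_iff algebra_simps)

lemma module_fun_scale: "module fun_scale"
  by (simp add: module_iff_vector_space vector_space_fun_scale)

lemma scl_tensor_space [simp]: "scl (tensor_space V W) = fun_scale"
  by (simp add: tensor_space_def)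

lemma is_cspace_tensor_space: "is_cspace (tensor_space V W)"
  by (simp add: is_cspace_def tensor_space_def vector_space_fun_scale module.subspace_span module_fun_scale)

lemma ptens_in_tensor_space:
  "v \<in> vecs V \<Longrightarrow> w \<in> vecs W \<Longrightarrow> ptens V W v w \<in> vecs (tensor_space V W)"
  unfolding tensor_space_def by (auto intro!: module.span_base[OF module_fun_scale])

lemma linear_map_ptens_left:
  "w \<in> vecs W \<Longrightarrow> linear_map V (tensor_space V W) (\<lambda>v. ptens V W v w)"
  by (intro linear_mapI ptens_in_tensor_space)
    (auto simp: ptens_def fun_eq_iff fun_scale_def bilinear_form_def)

lemma linear_map_ptens_right:
  "v \<in> vecs V \<Longrightarrow> linear_map W (tensor_space V W) (ptens V W v)"
  by (intro linear_mapI ptens_in_tensor_space)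
    (auto simp: ptens_def fun_eq_iff fun_scale_def bilinear_form_def)

text \<open>A tensor is a functional on bilinear forms, so its \<open>(i, j)\<close> coordinate is
  its value at the form multiplying the two coordinates. Linearity in the tensor is then
  immediate.\<close>

definition tensor_coord ::
  "('v \<Rightarrow> 'i \<Rightarrow> complex) \<Rightarrow> ('w \<Rightarrow> 'j \<Rightarrow> complex) \<Rightarrow> ('v, 'w) tens \<Rightarrow> 'i \<times> 'j \<Rightarrow> complex" where
  "tensor_coord c d t = (\<lambda>(i, j). t (\<lambda>v w. c v i * d w j))"

text \<open>The content is that tensors of basis vectors span. The tensors equal to their own
  expansion form a subspace, and it contains every pure tensor, as expanding both factors
  shows.\<close>

lemma has_basis_tensor_space:
  assumes V: "has_basis V I e c" and W: "has_basis W J f d"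
  shows "has_basis (tensor_space V W) (I \<times> J) (\<lambda>(i, j). ptens V W (e i) (f j)) (tensor_coord c d)"
proof -
  note v = has_basisD[OF V] and w = has_basisD[OF W]
  interpret T: module fun_scale by (rule module_fun_scale)
  \<comment> \<open>\<open>ptens\<close> returns 0 at arguments that are not bilinear forms, so this
    is needed before a pure tensor can be evaluated at a product of coordinates.\<close>
  have bil: "bilinear_form V W (\<lambda>v w. c v i * d w j)" if "i \<in> I" "j \<in> J" for i j
    using that by (auto simp: bilinear_form_def v w algebra_simps)
  let ?exp = "\<lambda>t. \<Sum>(i, j)\<in>I \<times> J. fun_scale (tensor_coord c d t (i, j)) (ptens V W (e i) (f j))"
  have expansion: "?exp t = t" if "t \<in> vecs (tensor_space V W)" for t
  proof -
    have "T.subspace {t. ?exp t = t}"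
    proof (rule T.subspaceI)
      show "0 \<in> {t. ?exp t = t}"
        by (simp add: tensor_coord_def fun_scale_def zero_fun_def split_def fun_eq_iff)
    next
      fix s t assume "s \<in> {t. ?exp t = t}" "t \<in> {t. ?exp t = t}"
      then have "?exp s = s" "?exp t = t" by auto
      moreover have "?exp (s + t) = ?exp s + ?exp t"
        by (simp add: tensor_coord_def split_def T.scale_left_distrib sum.distrib)
      ultimately show "s + t \<in> {t. ?exp t = t}" by simp
    next
      fix k t assume "t \<in> {t. ?exp t = t}"
      then have "?exp t = t" by auto
      moreover have "?exp (fun_scale k t) = fun_scale k (?exp t)"
        unfolding T.scale_sum_right split_def
        by (simp add: tensor_coord_def fun_scale_def split_def mult.assoc)
      ultimately show "fun_scale k t \<in> {t. ?exp t = t}" by simp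
    qed
    moreover have "?exp (ptens V W x y) = ptens V W x y" if "x \<in> vecs V" "y \<in> vecs W" for x y
    proof -
      have "ptens V W x y = ptens V W (\<Sum>i\<in>I. scl V (c x i) (e i)) y"
        using that by (simp add: v(8))
      also have "\<dots> = (\<Sum>i\<in>I. fun_scale (c x i) (ptens V W (e i) y))"
        using that
        by (simp add: linear_map_sum[OF v(1) linear_map_ptens_left] v(4) is_cspace_closed(3)[OF v(1)]
            linear_mapD(3)[OF linear_map_ptens_left])
      also have "\<dots> = (\<Sum>i\<in>I. fun_scale (c x i) (\<Sum>j\<in>J. fun_scale (d y j) (ptens V W (e i) (f j))))"
      proof (rule sum.cong[OF refl])
        fix i assume i: "i \<in> I"
        have "ptens V W (e i) y = ptens V W (e i) (\<Sum>j\<in>J. scl W (d y j) (f j))"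
          using that by (simp add: w(8))
        also have "\<dots> = (\<Sum>j\<in>J. fun_scale (d y j) (ptens V W (e i) (f j)))"
          using i
          by (simp add: linear_map_sum[OF w(1) linear_map_ptens_right] v(4) w(4)
              is_cspace_closed(3)[OF w(1)] linear_mapD(3)[OF linear_map_ptens_right])
        finally show "fun_scale (c x i) (ptens V W (e i) y) =
          fun_scale (c x i) (\<Sum>j\<in>J. fun_scale (d y j) (ptens V W (e i) (f j)))" by simp
      qed
      also have "\<dots> = ?exp (ptens V W x y)"
        unfolding T.scale_sum_right sum.cartesian_product
        using bil by (intro sum.cong) (auto simp: tensor_coord_def ptens_def)
      finally show ?thesis by simp
    qed
    ultimately have "T.span {ptens V W x y | x y. x \<in> vecs V \<and> y \<in> vecs W} \<subseteq> {t. ?exp t = t}"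
      by (intro T.span_minimal) auto
    then show ?thesis using that by (auto simp: tensor_space_def)
  qed
  show ?thesis
    unfolding has_basis_def
  proof (intro conjI)
    show "\<forall>t\<in>vecs (tensor_space V W). t =
      (\<Sum>i\<in>I \<times> J. scl (tensor_space V W) (tensor_coord c d t i) (case i of (i, j) \<Rightarrow> ptens V W (e i) (f j)))"
      using expansion by (simp add: split_def)
    show "(\<lambda>(i, j). ptens V W (e i) (f j)) ` (I \<times> J) \<subseteq> vecs (tensor_space V W)"
      by (auto intro!: ptens_in_tensor_space v(4) w(4))
  qed (use bil in \<open>auto simp: is_cspace_tensor_space v(2,7) w(2,7) tensor_coord_def ptens_def fun_scale_def\<close>)
qed

text \<open>The definition prescribes the map on all pure tensors. Its instances at basis tensors
  already determine the map, and bilinearity of both sides gives back the full prescription.\<close>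

lemma tensor_map_props:
  assumes V: "has_basis V I e c" and W: "has_basis W J d k"
    and V': "is_cspace V'" and W': "is_cspace W'"
    and f: "linear_map V V' f" and g: "linear_map W W' g"
  shows "linear_map (tensor_space V W) (tensor_space V' W') (tensor_map V V' W W' f g)"
    and "tensor_map V V' W W' f g \<in> extensional (vecs (tensor_space V W))"
    and "v \<in> vecs V \<Longrightarrow> w \<in> vecs W \<Longrightarrow>
      tensor_map V V' W W' f g (ptens V W v w) = ptens V' W' (f v) (g w)"
proof -
  note v = has_basisD[OF V] and w = has_basisD[OF W]
  let ?P = "\<lambda>h. \<forall>v\<in>vecs V. \<forall>w\<in>vecs W. h (ptens V W v w) = ptens V' W' (f v) (g w)"
  have P: "?P h \<longleftrightarrow> (\<forall>ij\<in>I \<times> J. h (case ij of (i, j) \<Rightarrow> ptens V W (e i) (d j)) =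
      (case ij of (i, j) \<Rightarrow> ptens V' W' (f (e i)) (g (d j))))"
    if h: "linear_map (tensor_space V W) (tensor_space V' W') h" for h
  proof
    assume R: "\<forall>ij\<in>I \<times> J. h (case ij of (i, j) \<Rightarrow> ptens V W (e i) (d j)) =
      (case ij of (i, j) \<Rightarrow> ptens V' W' (f (e i)) (g (d j)))"
    show "?P h"
    proof (intro ballI)
      fix x y assume "x \<in> vecs V" "y \<in> vecs W"
      show "h (ptens V W x y) = ptens V' W' (f x) (g y)"
      proof (rule bilinear_eq_on_span[OF v(1) w(1) v(3) w(3), where U = "tensor_space V' W'"
            and F = "\<lambda>x y. h (ptens V W x y)" and H = "\<lambda>x y. ptens V' W' (f x) (g y)"])
        show "linear_map V (tensor_space V' W') (\<lambda>x. h (ptens V W x y))" if "y \<in> vecs W" for y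
          using linear_map_comp[OF linear_map_ptens_left h] that .
        show "linear_map W (tensor_space V' W') (\<lambda>y. h (ptens V W x y))" if "x \<in> vecs V" for x
          using linear_map_comp[OF linear_map_ptens_right h] that .
        show "linear_map V (tensor_space V' W') (\<lambda>x. ptens V' W' (f x) (g y))" if "y \<in> vecs W" for y
          using linear_map_comp[OF f linear_map_ptens_left] linear_mapD(1)[OF g] that by blast
        show "linear_map W (tensor_space V' W') (\<lambda>y. ptens V' W' (f x) (g y))" if "x \<in> vecs V" for x
          using linear_map_comp[OF g linear_map_ptens_right] linear_mapD(1)[OF f] that by blast
      qed (use R \<open>x \<in> vecs V\<close> \<open>y \<in> vecs W\<close> in \<open>auto simp: has_basis_span[OF V] has_basis_span[OF W]\<close>)
    qed
  qed (auto simp: v(4) w(4))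
  note * = the_linear_map_basis[OF has_basis_tensor_space[OF V W] is_cspace_tensor_space _ P]
  have im: "(case ij of (i, j) \<Rightarrow> ptens V' W' (f (e i)) (g (d j))) \<in> vecs (tensor_space V' W')"
    if "ij \<in> I \<times> J" for ij
    using that by (auto intro!: ptens_in_tensor_space linear_mapD(1)[OF f] linear_mapD(1)[OF g] simp: v(4) w(4))
  show "linear_map (tensor_space V W) (tensor_space V' W') (tensor_map V V' W W' f g)"
    and "tensor_map V V' W W' f g \<in> extensional (vecs (tensor_space V W))"
    and "v \<in> vecs V \<Longrightarrow> w \<in> vecs W \<Longrightarrow>
      tensor_map V V' W W' f g (ptens V W v w) = ptens V' W' (f v) (g w)"
    using *[OF im] by (auto simp: tensor_map_def)
qed

lemma coord_sum:
  assumes B: "has_basis V I e c" and i: "i \<in> I" and x: "\<And>k. k \<in> K \<Longrightarrow> x k \<in> vecs V"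
  shows "c (\<Sum>k\<in>K. x k) i = (\<Sum>k\<in>K. c (x k) i)"
proof -
  note D = has_basisD[OF B]
  have "c 0 i = 0" using D(5)[OF i, of 0 0] is_cspace_closed(1)[OF D(1)] by simp
  then show ?thesis
    using x by (induction K rule: infinite_finite_induct)
      (simp_all add: D(5)[OF i] is_cspace_closed[OF D(1)])
qed


section \<open>The matched pair structure in terms of the coset map\<close>

locale coset_system = coset_data X G M + group X
  for X :: "('x, 'k) monoid_scheme" (structure) and G M :: "'x set" +
  assumes finite_carrier: "finite (carrier X)"
    and subgroup_G: "subgroup G X"
    and M_subset: "M \<subseteq> carrier X"
    and one_in_M: "\<one> \<in> M"
    and factor_ex1: "\<forall>x\<in>carrier X. \<exists>!(u, s). u \<in> G \<and> s \<in> M \<and> x = u \<otimes> s"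
    and rinv_ex1: "\<forall>t\<in>M. \<exists>!r. r \<in> M \<and> t \<odot> r = \<one>"
    and grade_ex1: "\<forall>s\<in>M. \<forall>u\<in>G. \<exists>!a. a \<in> M \<and> s \<odot> a = s \<lhd>\<^sub>M u"
begin

lemma M_carrier [simp]: "s \<in> M \<Longrightarrow> s \<in> carrier X"
  using M_subset by blast

lemma G_carrier [simp]: "u \<in> G \<Longrightarrow> u \<in> carrier X"
  using subgroup.subset[OF subgroup_G] by blast

lemma G_closed [simp]:
  "\<one> \<in> G" "u \<in> G \<Longrightarrow> v \<in> G \<Longrightarrow> u \<otimes> v \<in> G" "u \<in> G \<Longrightarrow> inv u \<in> G"
  using subgroup_G by (auto simp: subgroup.one_closed subgroup.m_closed subgroup.m_inv_closed)

lemma finite_MG: "finite M" "finite G"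
  using finite_carrier M_subset subgroup.subset[OF subgroup_G] by (auto intro: finite_subset)

lemma parts_unique:
  assumes "u \<in> G" "s \<in> M"
  shows "gpart (u \<otimes> s) = u" "mpart (u \<otimes> s) = s"
proof -
  have "\<exists>!(v, t). v \<in> G \<and> t \<in> M \<and> u \<otimes> s = v \<otimes> t"
    using bspec[OF factor_ex1, of "u \<otimes> s"] assms by simp
  then obtain p where
    p: "\<And>q. (case q of (v, t) \<Rightarrow> v \<in> G \<and> t \<in> M \<and> u \<otimes> s = v \<otimes> t) \<Longrightarrow> q = p"
    by (elim ex1E) blast
  have *: "v = u \<and> t = s" if "v \<in> G" "t \<in> M" "u \<otimes> s = v \<otimes> t" for v t
  proof -
    have "(v, t) = p" by (rule p) (use that in simp)
    moreover have "(u, s) = p" by (rule p) (use assms in simp)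
    ultimately show ?thesis by auto
  qed
  show "gpart (u \<otimes> s) = u"
    unfolding gpart_def by (rule the_equality) (use assms * in metis)+
  show "mpart (u \<otimes> s) = s"
    unfolding mpart_def by (rule the_equality) (use assms * in metis)+
qed

lemma parts:
  assumes "x \<in> carrier X"
  shows "gpart x \<in> G" "mpart x \<in> M" "gpart x \<otimes> mpart x = x"
proof -
  obtain u s where "u \<in> G" "s \<in> M" "x = u \<otimes> s"
    using bspec[OF factor_ex1 assms] by blast
  then show "gpart x \<in> G" "mpart x \<in> M" "gpart x \<otimes> mpart x = x"
    using parts_unique[of u s] by simp_all
qed

lemma parts_carrier [simp]:
  "x \<in> carrier X \<Longrightarrow> gpart x \<in> carrier X" "x \<in> carrier X \<Longrightarrow> mpart x \<in> carrier X"
  using parts by auto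

text \<open>Eliminates \<open>gpart\<close>, and with it \<open>tau\<close> and
  \<open>\<rhd>\<close>, in favour of words whose only non-group operation is
  \<open>mpart\<close>.\<close>

lemma gpart_eq: "x \<in> carrier X \<Longrightarrow> gpart x = x \<otimes> inv mpart x"
  using parts[of x] by (metis G_carrier M_carrier inv_solve_right)

lemma mpart_M [simp]: "s \<in> M \<Longrightarrow> mpart s = s"
  using parts_unique(2)[of \<one> s] by simp

text \<open>\<open>mpart x\<close> depends only on the coset \<open>G x\<close>, which left
  multiplication by \<open>u\<close> leaves unchanged.\<close>

lemma mpart_G_mult [simp]:
  assumes "u \<in> G" "x \<in> carrier X"
  shows "mpart (u \<otimes> x) = mpart x"
proof -
  have "u \<otimes> x = (u \<otimes> gpart x) \<otimes> mpart x"
    using assms parts[of x] by (simp add: m_assoc)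
  then show ?thesis
    using parts_unique(2)[of "u \<otimes> gpart x" "mpart x"] assms parts[of x] by simp
qed

lemma mpart_G [simp]: "u \<in> G \<Longrightarrow> mpart u = \<one>"
  using parts_unique(2)[of u \<one>] one_in_M by simp

lemma mpart_eq_one_iff: "x \<in> carrier X \<Longrightarrow> mpart x = \<one> \<longleftrightarrow> x \<in> G"
  using parts[of x] by auto

text \<open>Right multiplication by \<open>y\<close> is well defined on the cosets of
  \<open>G\<close>. This is the composition law of the action of \<open>X\<close> on
  \<open>M\<close>; as a rewrite rule it removes an \<open>mpart\<close> in leading
  position.\<close>

lemma mpart_mpart_mult [simp]:
  assumes "x \<in> carrier X" "y \<in> carrier X"
  shows "mpart (mpart x \<otimes> y) = mpart (x \<otimes> y)"
proof -
  have "x \<otimes> y = gpart x \<otimes> (mpart x \<otimes> y)"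
    using assms parts[of x] by (simp flip: m_assoc)
  then show ?thesis using assms parts[of x] by simp
qed

lemma mpart_mpart [simp]: "x \<in> carrier X \<Longrightarrow> mpart (mpart x) = mpart x"
  by (simp add: parts)

text \<open>Right multiplication by \<open>z\<close> permutes the cosets, with inverse given by
  \<open>inv z\<close>. This is the cancellation used to compare the conditions under which products
  vanish.\<close>

lemma mpart_mult_cancel:
  assumes "x \<in> carrier X" "y \<in> carrier X" "z \<in> carrier X"
  shows "mpart (x \<otimes> z) = mpart (y \<otimes> z) \<longleftrightarrow> mpart x = mpart y"
proof
  assume "mpart (x \<otimes> z) = mpart (y \<otimes> z)"
  then have "mpart (mpart (x \<otimes> z) \<otimes> inv z) = mpart (mpart (y \<otimes> z) \<otimes> inv z)" by simp
  then show "mpart x = mpart y" using assms by (simp add: m_assoc)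
next
  assume "mpart x = mpart y"
  then have "mpart (mpart x \<otimes> z) = mpart (mpart y \<otimes> z)" by simp
  then show "mpart (x \<otimes> z) = mpart (y \<otimes> z)" using assms by simp
qed

text \<open>Words are kept bracketed to the right, so a letter and its inverse usually meet in front
  of a tail.\<close>

lemma inv_cancel_left [simp]:
  "x \<in> carrier X \<Longrightarrow> y \<in> carrier X \<Longrightarrow> x \<otimes> (inv x \<otimes> y) = y"
  "x \<in> carrier X \<Longrightarrow> y \<in> carrier X \<Longrightarrow> inv x \<otimes> (x \<otimes> y) = y"
  by (simp_all flip: m_assoc)

lemma tau_eq: "s \<in> M \<Longrightarrow> t \<in> M \<Longrightarrow> tau s t = s \<otimes> (t \<otimes> inv mpart (s \<otimes> t))"
  by (simp add: tau_def gpart_eq m_assoc)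

lemma gact_eq: "s \<in> M \<Longrightarrow> u \<in> G \<Longrightarrow> s \<rhd> u = s \<otimes> (u \<otimes> inv mpart (s \<otimes> u))"
  by (simp add: gact_def gpart_eq m_assoc)

lemma operations_closed [simp]:
  "s \<in> M \<Longrightarrow> t \<in> M \<Longrightarrow> tau s t \<in> G" "s \<in> M \<Longrightarrow> t \<in> M \<Longrightarrow> s \<odot> t \<in> M"
  "s \<in> M \<Longrightarrow> u \<in> G \<Longrightarrow> s \<rhd> u \<in> G" "s \<in> M \<Longrightarrow> u \<in> G \<Longrightarrow> s \<lhd>\<^sub>M u \<in> M"
  by (auto simp: tau_def mdot_def gact_def mact_def intro!: parts)

lemmas word_simps = m_assoc inv_mult_group

lemma mact_one: "s \<in> M \<Longrightarrow> s \<lhd>\<^sub>M \<one> = s"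
  by (simp add: mact_def)

lemma gact_one: "s \<in> M \<Longrightarrow> s \<rhd> \<one> = \<one>"
  by (simp add: gact_eq)

text \<open>\<open>r \<odot> t = \<one>\<close> means that \<open>r \<otimes> t\<close> lies in
  \<open>G\<close>, that is, \<open>r\<close> represents the coset of \<open>inv t\<close>.\<close>

lemma linv_eq:
  assumes "t \<in> M"
  shows "linv t = mpart (inv t)"
  unfolding linv_def
proof (rule the_equality)
  show "mpart (inv t) \<in> M \<and> mpart (inv t) \<odot> t = \<one>"
    using assms by (simp add: mdot_def parts)
next
  fix r assume r: "r \<in> M \<and> r \<odot> t = \<one>"
  then have "mpart (mpart (r \<otimes> t) \<otimes> inv t) = mpart (inv t)"
    using assms by (simp add: mdot_def)
  then show "r = mpart (inv t)"
    using r assms by (simp add: m_assoc)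
qed

lemma rinv_props:
  assumes "t \<in> M"
  shows "rinv t \<in> M" "t \<odot> rinv t = \<one>"
  using theI'[of "\<lambda>r. r \<in> M \<and> t \<odot> r = \<one>"] rinv_ex1 assms unfolding rinv_def by auto

lemma rinv_eqI: "t \<in> M \<Longrightarrow> r \<in> M \<Longrightarrow> t \<odot> r = \<one> \<Longrightarrow> rinv t = r"
  unfolding rinv_def using rinv_ex1 by (intro the1_equality) auto

lemma linv_closed [simp]: "t \<in> M \<Longrightarrow> linv t \<in> M"
  by (simp add: linv_eq parts)

text \<open>Left inversion is given by a coset formula, right inversion by the uniqueness
  hypothesis. That the two are mutually inverse on \<open>M\<close> lets \<open>rinv\<close> be
  traded for \<open>linv\<close>.\<close>

lemma rinv_linv [simp]: "t \<in> M \<Longrightarrow> rinv (linv t) = t"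
  by (intro rinv_eqI) (simp_all add: linv_eq mdot_def parts)

lemma linv_rinv [simp]:
  assumes "t \<in> M"
  shows "linv (rinv t) = t"
proof -
  have "mpart (mpart (t \<otimes> rinv t) \<otimes> inv rinv t) = mpart (inv rinv t)"
    using rinv_props[OF assms] by (simp add: mdot_def)
  then show ?thesis
    using assms rinv_props[OF assms] by (simp add: linv_eq m_assoc)
qed

lemma rinv_closed [simp]: "t \<in> M \<Longrightarrow> rinv t \<in> M"
  by (rule rinv_props)

lemma rinv_eq_iff: "p \<in> M \<Longrightarrow> r \<in> M \<Longrightarrow> rinv p = r \<longleftrightarrow> p = linv r"
  by auto


section \<open>The structure of the algebra on basis indices\<close>

definition gr :: "'x \<times> 'x \<Rightarrow> 'x" where
  "gr i = A_grade (fst i) (snd i)"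

definition act_ix :: "'x \<times> 'x \<Rightarrow> 'x \<Rightarrow> 'x \<times> 'x" where
  "act_ix i v = (let g = gr i \<rhd> v in (fst i \<lhd>\<^sub>M g, inv g \<otimes> snd i \<otimes> v))"

text \<open>The Kronecker delta of the product. With \<open>(s, u)\<close> seen as an arrow from its
  start \<open>s\<close> to its end \<open>s \<lhd>\<^sub>M u\<close>, two basis vectors have a
  nonzero product when the arrows meet.\<close>

definition composable :: "'x \<times> 'x \<Rightarrow> 'x \<times> 'x \<Rightarrow> bool" where
  "composable i j \<longleftrightarrow> fst j = fst i \<lhd>\<^sub>M snd i"

definition mul_ix :: "'x \<times> 'x \<Rightarrow> 'x \<times> 'x \<Rightarrow> 'x \<times> 'x" where
  "mul_ix i j = (let g = tau (gr i) (gr j) in (fst i \<lhd>\<^sub>M g, inv g \<otimes> snd i \<otimes> snd j))"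

definition star_ix :: "'x \<times> 'x \<Rightarrow> 'x \<times> 'x" where
  "star_ix i = (let g = tau (gr i) (rinv (gr i))
     in act_ix (fst i \<lhd>\<^sub>M snd i, inv (snd i) \<otimes> g) (inv g))"

lemma A_grade_props:
  assumes "s \<in> M" "u \<in> G"
  shows "A_grade s u \<in> M" "mpart (s \<otimes> A_grade s u) = mpart (s \<otimes> u)"
  using theI'[of "\<lambda>a. a \<in> M \<and> s \<odot> a = s \<lhd>\<^sub>M u"] grade_ex1 assms
  unfolding A_grade_def mdot_def mact_def by auto

lemma A_grade_eqI:
  "s \<in> M \<Longrightarrow> u \<in> G \<Longrightarrow> a \<in> M \<Longrightarrow> mpart (s \<otimes> a) = mpart (s \<otimes> u) \<Longrightarrow> A_grade s u = a"
  unfolding A_grade_def using grade_ex1 by (intro the1_equality) (auto simp: mdot_def mact_def)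

text \<open>Normalises words starting with \<open>s \<otimes> u\<close>, since \<open>s \<odot> a = s \<lhd>\<^sub>M u\<close> for the grade \<open>a\<close>.\<close>

lemma grade_rewrite:
  assumes "s \<in> M" "u \<in> G"
  shows "mpart (s \<otimes> u) = mpart (s \<otimes> A_grade s u)"
    and "x \<in> carrier X \<Longrightarrow> mpart (s \<otimes> (u \<otimes> x)) = mpart (s \<otimes> (A_grade s u \<otimes> x))"
proof -
  show *: "mpart (s \<otimes> u) = mpart (s \<otimes> A_grade s u)"
    using A_grade_props[OF assms] by simp
  show "mpart (s \<otimes> (u \<otimes> x)) = mpart (s \<otimes> (A_grade s u \<otimes> x))" if "x \<in> carrier X"
    using mpart_mult_cancel[of "s \<otimes> u" "s \<otimes> A_grade s u" x] * assms A_grade_props(1)[OF assms] that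
    by (simp add: m_assoc)
qed

lemma ix_closed [simp]:
  assumes "i \<in> M \<times> G"
  shows "fst i \<in> M" "snd i \<in> G" "gr i \<in> M"
  using assms by (auto simp: gr_def A_grade_props)

lemma gr_eqI:
  "i \<in> M \<times> G \<Longrightarrow> a \<in> M \<Longrightarrow> mpart (fst i \<otimes> a) = mpart (fst i \<otimes> snd i) \<Longrightarrow> gr i = a"
  unfolding gr_def by (rule A_grade_eqI) auto

lemma act_ix_closed [simp]: "i \<in> M \<times> G \<Longrightarrow> v \<in> G \<Longrightarrow> act_ix i v \<in> M \<times> G"
  by (simp add: act_ix_def Let_def)

lemma mul_ix_closed [simp]: "i \<in> M \<times> G \<Longrightarrow> j \<in> M \<times> G \<Longrightarrow> mul_ix i j \<in> M \<times> G"
  by (simp add: mul_ix_def Let_def)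

text \<open>With \<open>a\<close> and \<open>b\<close> grades, \<open>a \<rhd> v\<close> is
  \<open>a \<otimes> v\<close> divided on the right by its representative, and
  \<open>tau a b\<close> is the same quotient of \<open>a \<otimes> b\<close>. Substituting these
  turns the components of the index operations into words.\<close>

lemma fst_act_ix: "i \<in> M \<times> G \<Longrightarrow> v \<in> G \<Longrightarrow>
    fst (act_ix i v) = mpart (fst i \<otimes> (gr i \<otimes> (v \<otimes> inv mpart (gr i \<otimes> v))))"
  by (simp add: act_ix_def mact_def gact_eq word_simps)

lemma snd_act_ix: "i \<in> M \<times> G \<Longrightarrow> v \<in> G \<Longrightarrow>
    snd (act_ix i v) = mpart (gr i \<otimes> v) \<otimes> (inv v \<otimes> (inv gr i \<otimes> (snd i \<otimes> v)))"
  by (simp add: act_ix_def gact_eq word_simps)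

lemma fst_mul_ix: "i \<in> M \<times> G \<Longrightarrow> j \<in> M \<times> G \<Longrightarrow>
    fst (mul_ix i j) = mpart (fst i \<otimes> (gr i \<otimes> (gr j \<otimes> inv mpart (gr i \<otimes> gr j))))"
  by (simp add: mul_ix_def mact_def tau_eq word_simps)

lemma snd_mul_ix: "i \<in> M \<times> G \<Longrightarrow> j \<in> M \<times> G \<Longrightarrow>
    snd (mul_ix i j) = mpart (gr i \<otimes> gr j) \<otimes> (inv gr j \<otimes> (inv gr i \<otimes> (snd i \<otimes> snd j)))"
  by (simp add: mul_ix_def tau_eq word_simps)

lemma gr_rewrite:
  assumes "i \<in> M \<times> G"
  shows "mpart (fst i \<otimes> snd i) = mpart (fst i \<otimes> gr i)"
    and "x \<in> carrier X \<Longrightarrow> mpart (fst i \<otimes> (snd i \<otimes> x)) = mpart (fst i \<otimes> (gr i \<otimes> x))"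
  using grade_rewrite[of "fst i" "snd i"] assms by (simp_all add: gr_def)

text \<open>Put \<open>m = mpart (a \<otimes> v)\<close>, where \<open>a\<close> is the grade of
  \<open>i = (s, u)\<close>. Acting moves \<open>s\<close> by
  \<open>a \<otimes> v \<otimes> inv m\<close>, so a further move by \<open>m\<close> leads to the
  class of \<open>s a v\<close>, which is also that of \<open>s u v\<close>. Uniqueness of grades
  gives \<open>m\<close>.\<close>

lemma gr_act_ix:
  assumes "i \<in> M \<times> G" "v \<in> G"
  shows "gr (act_ix i v) = mpart (gr i \<otimes> v)"
  using assms
  by (intro gr_eqI) (simp_all add: parts fst_act_ix snd_act_ix gr_rewrite word_simps)

lemma composable_iff:
  "i \<in> M \<times> G \<Longrightarrow> composable i j \<longleftrightarrow> fst j = mpart (fst i \<otimes> gr i)"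
  by (simp add: composable_def mact_def gr_rewrite)

text \<open>The argument for the action, with \<open>m = mpart (a \<otimes> b)\<close>.
  Composability says that the second arrow starts where \<open>a\<close> sends \<open>s\<close>, so
  that its grade \<open>b\<close> may replace its group element there.\<close>

lemma gr_mul_ix:
  assumes "i \<in> M \<times> G" "j \<in> M \<times> G" "composable i j"
  shows "gr (mul_ix i j) = mpart (gr i \<otimes> gr j)"
proof -
  have "mpart (fst i \<otimes> (gr i \<otimes> snd j)) = mpart (fst i \<otimes> (gr i \<otimes> gr j))"
    using gr_rewrite(1)[OF assms(2)] assms by (simp add: composable_iff m_assoc)
  then show ?thesis
    using assms
    by (intro gr_eqI) (simp_all add: parts fst_mul_ix snd_mul_ix gr_rewrite word_simps)
qed

lemmas ix_simps = fst_act_ix snd_act_ix fst_mul_ix snd_mul_ix gr_act_ix gr_mul_ix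

lemma act_ix_one: "i \<in> M \<times> G \<Longrightarrow> act_ix i \<one> = i"
  by (simp add: act_ix_def gact_one mact_one)

text \<open>The underlying identity is \<open>a \<rhd> (v \<otimes> w) = (a \<rhd> v) \<otimes> ((a
  \<lhd>\<^sub>M v) \<rhd> w)\<close>, in which the intermediate representative cancels.\<close>

lemma act_ix_mult:
  "i \<in> M \<times> G \<Longrightarrow> v \<in> G \<Longrightarrow> w \<in> G \<Longrightarrow> act_ix i (v \<otimes> w) = act_ix (act_ix i v) w"
  by (simp add: prod_eq_iff ix_simps word_simps)

text \<open>The element \<open>gr j \<rhd> w\<close> acting on the left factor moves its end, and
  the same element moves the start of the right factor; it cancels from the condition.\<close>

lemma composable_act_ix:
  assumes "i \<in> M \<times> G" "j \<in> M \<times> G" "w \<in> G"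
  shows "composable (act_ix i (gr j \<rhd> w)) (act_ix j w) \<longleftrightarrow> composable i j"
proof -
  have "composable (act_ix i (gr j \<rhd> w)) (act_ix j w) \<longleftrightarrow>
    mpart (fst j \<otimes> (gr j \<rhd> w)) = mpart (mpart (fst i \<otimes> gr i) \<otimes> (gr j \<rhd> w))"
    using assms by (simp add: composable_iff ix_simps) (simp add: gact_eq word_simps)
  also have "\<dots> \<longleftrightarrow> composable i j"
    using assms by (subst mpart_mult_cancel) (simp_all add: composable_iff)
  finally show ?thesis .
qed

lemma mul_ix_act_ix:
  assumes "i \<in> M \<times> G" "j \<in> M \<times> G" "w \<in> G" "composable i j"
  shows "mul_ix (act_ix i (gr j \<rhd> w)) (act_ix j w) = act_ix (mul_ix i j) w"
  using assms composable_act_ix[OF assms(1-3)]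
  by (simp add: prod_eq_iff ix_simps) (simp add: gact_eq word_simps)

text \<open>Both bracketings must vanish together. The associator moves the left factor by
  \<open>tau (gr j) (gr k)\<close>, and multiplying \<open>j\<close> by \<open>k\<close> moves the
  start of \<open>j\<close> by the same element, so the conditions joining \<open>i\<close> and
  \<open>j\<close> agree. Those joining \<open>j\<close> and \<open>k\<close> agree because
  \<open>mul_ix i j\<close> ends where \<open>j\<close> ends.\<close>

lemma composable_assoc:
  assumes "i \<in> M \<times> G" "j \<in> M \<times> G" "k \<in> M \<times> G"
  shows "composable i j \<and> composable (mul_ix i j) k \<longleftrightarrow>
    composable j k \<and> composable (act_ix i (tau (gr j) (gr k))) (mul_ix j k)"
proof -
  define g where "g = tau (gr j) (gr k)"
  have g: "g \<in> G" using assms by (simp add: g_def)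
  have "composable (act_ix i g) (mul_ix j k) \<longleftrightarrow>
    mpart (fst j \<otimes> g) = mpart (mpart (fst i \<otimes> gr i) \<otimes> g)"
    using assms g by (simp add: composable_iff ix_simps word_simps)
      (simp add: g_def tau_eq word_simps)
  also have "\<dots> \<longleftrightarrow> composable i j"
    using assms g by (subst mpart_mult_cancel) (simp_all add: composable_iff)
  finally have 1: "composable (act_ix i g) (mul_ix j k) \<longleftrightarrow> composable i j" .
  have "composable (mul_ix i j) k \<longleftrightarrow> composable j k" if "composable i j"
  proof -
    have "mpart (fst j \<otimes> gr j) = mpart (fst i \<otimes> (gr i \<otimes> gr j))"
      using that assms by (simp add: composable_iff m_assoc)
    then show ?thesis
      using that assms by (simp add: composable_iff[of j] composable_iff[of "mul_ix i j"] ix_simps word_simps)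
  qed
  then show ?thesis using 1 by (auto simp: g_def)
qed

text \<open>The representatives of partial products cancel as in the cocycle identity for
  \<open>tau\<close>. Composability enters through the grades of the inner products.\<close>

lemma mul_ix_assoc:
  assumes "i \<in> M \<times> G" "j \<in> M \<times> G" "k \<in> M \<times> G"
    and "composable i j" "composable (mul_ix i j) k"
  shows "mul_ix (mul_ix i j) k = mul_ix (act_ix i (tau (gr j) (gr k))) (mul_ix j k)"
  using assms composable_assoc[OF assms(1-3)]
  by (simp add: prod_eq_iff ix_simps) (simp add: tau_eq word_simps)

lemma gr_unit: "t \<in> M \<Longrightarrow> gr (t, \<one>) = \<one>"
  by (rule gr_eqI) (simp_all add: one_in_M)

text \<open>An index meets exactly one \<open>(t, \<one>)\<close> on either side, the one at its
  start or at its end, so a single term of the sum defining the unit survives in a product.\<close>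

lemma mul_ix_unit:
  assumes "j \<in> M \<times> G" "t \<in> M"
  shows "composable (t, \<one>) j \<longleftrightarrow> t = fst j" "composable j (t, \<one>) \<longleftrightarrow> t = mpart (fst j \<otimes> snd j)"
    and "t = fst j \<Longrightarrow> mul_ix (t, \<one>) j = j" "mul_ix j (t, \<one>) = j"
  using assms by (auto simp: composable_def mact_def prod_eq_iff ix_simps gr_unit one_in_M word_simps)

lemma act_ix_unit:
  assumes "t \<in> M" "v \<in> G"
  shows "act_ix (t, \<one>) v = (mpart (t \<otimes> v), \<one>)"
  using assms by (simp add: prod_eq_iff ix_simps gr_unit word_simps)


section \<open>The involution on basis indices\<close>

lemma star_ix_closed [simp]: "i \<in> M \<times> G \<Longrightarrow> star_ix i \<in> M \<times> G"
  by (simp add: star_ix_def Let_def)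

text \<open>With \<open>a = gr i\<close>, the index inside the action in the definition has grade
  \<open>rinv a\<close>, and acting by the inverse of \<open>a \<otimes> rinv a\<close> carries this
  grade to the representative of \<open>inv a\<close>, the left inverse of \<open>a\<close>.\<close>

lemma star_ix_eq:
  assumes "i \<in> M \<times> G"
  shows "fst (star_ix i) = mpart (fst i \<otimes> inv mpart (inv gr i))"
    and "snd (star_ix i) = mpart (inv gr i) \<otimes> (gr i \<otimes> inv snd i)"
    and "gr (star_ix i) = mpart (inv gr i)"
proof -
  define r where "r = rinv (gr i)"
  define p where "p = (fst i \<lhd>\<^sub>M snd i, inv (snd i) \<otimes> (gr i \<otimes> r))"
  have r: "r \<in> M" "mpart (gr i \<otimes> r) = \<one>"
    using assms rinv_props[of "gr i"] by (auto simp: r_def mdot_def)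
  \<comment> \<open>Since \<open>gr i \<odot> r = \<one>\<close>, the product
    \<open>gr i \<otimes> r\<close> lies in \<open>G\<close> and is its own \<open>G\<close>
    part.\<close>
  have g: "tau (gr i) r = gr i \<otimes> r" "gr i \<otimes> r \<in> G"
    using assms r mpart_eq_one_iff[of "gr i \<otimes> r"] by (simp_all add: tau_eq)
  have p: "p \<in> M \<times> G" using assms g by (simp add: p_def)
  \<comment> \<open>At the end of \<open>i\<close>, the class of both \<open>s u\<close> and
    \<open>s a\<close>, the letter \<open>r\<close> and the group element
    \<open>inv u \<otimes> a \<otimes> r\<close> of \<open>p\<close> lead to the same class, that of
    \<open>s a r\<close>.\<close>
  have grp: "gr p = r"
    using assms r p
    by (intro gr_eqI) (simp_all add: p_def mact_def word_simps gr_rewrite(2))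
  have star: "star_ix i = act_ix p (inv (gr i \<otimes> r))"
    by (simp add: star_ix_def g p_def Let_def flip: r_def)
  show "fst (star_ix i) = mpart (fst i \<otimes> inv mpart (inv gr i))"
    and "snd (star_ix i) = mpart (inv gr i) \<otimes> (gr i \<otimes> inv snd i)"
    and "gr (star_ix i) = mpart (inv gr i)"
    using assms r p g grp unfolding star
    by (simp_all add: ix_simps) (simp_all add: p_def mact_def gr_rewrite word_simps)
qed

text \<open>Equivariance of the star: on the conjugate space \<open>v\<close> acts through
  \<open>rinv (gr (star_ix i)) \<rhd> v\<close>, and that right inverse is
  \<open>gr i\<close>.\<close>

lemma star_ix_act_ix:
  assumes "i \<in> M \<times> G" "v \<in> G"
  shows "star_ix (act_ix i v) = act_ix (star_ix i) (gr i \<rhd> v)"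
  using assms by (simp add: prod_eq_iff ix_simps star_ix_eq) (simp add: gact_eq word_simps)

text \<open>Put \<open>l = linv (gr i)\<close>. Then \<open>l \<otimes> gr i\<close> lies in
  \<open>G\<close> and equals \<open>tau l (gr i)\<close>, and on both sides the start of
  \<open>i\<close> is moved by \<open>inv l \<otimes> inv mpart (inv l)\<close>.\<close>

lemma star_ix_star_ix:
  assumes "i \<in> M \<times> G"
  shows "star_ix (star_ix i) = act_ix i (inv (tau (linv (gr i)) (gr i)))"
  using assms by (simp add: prod_eq_iff ix_simps star_ix_eq) (simp add: tau_eq linv_eq parts word_simps)

lemma star_ix_unit: "t \<in> M \<Longrightarrow> star_ix (t, \<one>) = (t, \<one>)"
  by (simp add: prod_eq_iff star_ix_eq gr_unit one_in_M)

text \<open>The involution reverses arrows up to a translation. Here \<open>linv a\<close> is the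
  grade of \<open>star_ix i\<close> and \<open>a\<close> its right inverse, so the acting element is
  the one in the inverse of \<Upsilon>. It moves the start of \<open>j\<close> to the end of the
  translated \<open>star_ix j\<close>, and the end of \<open>i\<close> to the start of
  \<open>star_ix i\<close>.\<close>

lemma composable_star_ix:
  assumes "i \<in> M \<times> G" "j \<in> M \<times> G"
  defines "a \<equiv> gr i"
  shows "composable (act_ix (star_ix j) (inv (tau (linv a) a))) (star_ix i) \<longleftrightarrow> composable i j"
proof -
  define k where "k = inv (tau (linv a) a)"
  \<comment> \<open>\<open>linv a \<otimes> a\<close> lies in \<open>G\<close>, hence is its own
    \<open>G\<close> part, and \<open>linv a\<close> is \<open>mpart (inv a)\<close>.\<close>
  have k: "k \<in> G" "k = inv a \<otimes> inv mpart (inv a)"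
    using assms by (simp_all add: k_def) (simp add: tau_eq linv_eq parts word_simps)
  have "composable (act_ix (star_ix j) k) (star_ix i) \<longleftrightarrow>
    mpart (mpart (fst i \<otimes> gr i) \<otimes> k) = mpart (fst j \<otimes> k)"
    using assms k(1) by (simp add: composable_iff ix_simps star_ix_eq word_simps)
      (simp add: k(2) word_simps)
  also have "\<dots> \<longleftrightarrow> composable i j"
    using assms k(1) by (subst mpart_mult_cancel) (simp_all add: composable_iff eq_commute)
  finally show ?thesis by (simp add: k_def)
qed

text \<open>Antimultiplicativity with the corrections from the inverse of \<Upsilon>. The grades of
  the starred factors are \<open>linv a\<close> and \<open>linv b\<close>, with right inverses
  \<open>a\<close> and \<open>b\<close>, whence \<open>tau a b\<close>; it stands outside the
  product because the action commutes with multiplication.\<close>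

lemma star_ix_mul_ix:
  assumes "i \<in> M \<times> G" "j \<in> M \<times> G" "composable i j"
  defines "a \<equiv> gr i" and "b \<equiv> gr j"
  shows "act_ix (mul_ix (act_ix (star_ix j) (inv (tau (linv a) a))) (star_ix i)) (tau a b) =
    star_ix (mul_ix i j)"
proof -
  define k where "k = inv (tau (linv a) a)"
  have k: "k \<in> G" "k = inv a \<otimes> inv mpart (inv a)"
    using assms by (simp_all add: k_def) (simp add: tau_eq linv_eq parts word_simps)
  have c: "composable (act_ix (star_ix j) k) (star_ix i)"
    using composable_star_ix[OF assms(1,2)] assms by (simp add: k_def)
  have j: "fst j = mpart (fst i \<otimes> a)"
    using assms by (simp add: composable_iff)
  show ?thesis
    using assms(1-3) k(1) c unfolding k_def[symmetric]
    by (simp add: prod_eq_iff ix_simps star_ix_eq a_def b_def)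
      (simp add: j k(2) a_def tau_eq word_simps)
qed


section \<open>Homogeneous bases permuted by the action\<close>

text \<open>A homogeneous basis that \<open>G\<close> permutes through the index map
  \<open>r\<close>. The notion passes to tensor products and conjugates, and both the algebra and
  the unit object have one. The laws making \<open>r\<close> an action are asked for in
  \<open>is_objectI\<close>.\<close>

definition has_gbasis ::
  "('x, 'v::ab_group_add) gspace \<Rightarrow> 'i set \<Rightarrow> ('i \<Rightarrow> 'v) \<Rightarrow> ('v \<Rightarrow> 'i \<Rightarrow> complex) \<Rightarrow>
    ('i \<Rightarrow> 'x) \<Rightarrow> ('i \<Rightarrow> 'x \<Rightarrow> 'i) \<Rightarrow> bool" where
  "has_gbasis V I e c g r \<longleftrightarrow>
     has_basis V I e c \<and> (\<forall>i\<in>I. g i \<in> M) \<and>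
     (\<forall>p\<in>M. grad V p = module.span (scl V) (e ` {i\<in>I. g i = p})) \<and>
     (\<forall>u\<in>G. linear_map V V (\<lambda>v. act V v u)) \<and>
     (\<forall>i\<in>I. \<forall>u\<in>G. r i u \<in> I \<and> act V (e i) u = e (r i u))"

lemma has_gbasisD:
  assumes "has_gbasis V I e c g r"
  shows "has_basis V I e c" and "i \<in> I \<Longrightarrow> g i \<in> M"
    and "p \<in> M \<Longrightarrow> grad V p = module.span (scl V) (e ` {i\<in>I. g i = p})"
    and "u \<in> G \<Longrightarrow> linear_map V V (\<lambda>v. act V v u)"
    and "i \<in> I \<Longrightarrow> u \<in> G \<Longrightarrow> r i u \<in> I"
    and "i \<in> I \<Longrightarrow> u \<in> G \<Longrightarrow> act V (e i) u = e (r i u)"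
    and "is_cspace V" and "i \<in> I \<Longrightarrow> e i \<in> vecs V" and "module (scl V)"
  using assms has_basisD[of V I e c] is_cspace_module[of V] by (auto simp: has_gbasis_def)

lemma grad_props:
  assumes B: "has_gbasis V I e c g r" and p: "p \<in> M"
  shows "module.subspace (scl V) (grad V p)" "grad V p \<subseteq> vecs V"
    and "i \<in> I \<Longrightarrow> g i = p \<Longrightarrow> e i \<in> grad V p"
    and "x \<in> grad V p \<Longrightarrow> i \<in> I \<Longrightarrow> g i \<noteq> p \<Longrightarrow> c x i = 0"
proof -
  note D = has_gbasisD[OF B] and H = has_basisD[OF has_gbasisD(1)[OF B]]
  interpret module "scl V" by (rule D(9))
  show "subspace (grad V p)"
    using D(3)[OF p] by simp
  show "grad V p \<subseteq> vecs V"
    unfolding D(3)[OF p] using H(1,3) by (intro span_minimal) (auto simp: is_cspace_def)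
  show "e i \<in> grad V p" if "i \<in> I" "g i = p"
    unfolding D(3)[OF p] using that by (intro span_base) auto
  have "c 0 i = 0" if "i \<in> I" for i
    using H(5)[OF that, of 0 0] is_cspace_closed(1)[OF D(7)] by simp
  then have "subspace {x \<in> vecs V. \<forall>i\<in>I. g i \<noteq> p \<longrightarrow> c x i = 0}"
    using is_cspace_closed[OF D(7)] by (auto simp: subspace_def H(5,6))
  then have "grad V p \<subseteq> {x \<in> vecs V. \<forall>i\<in>I. g i \<noteq> p \<longrightarrow> c x i = 0}"
    unfolding D(3)[OF p] using H(4,7) by (intro span_minimal) auto
  then show "c x i = 0" if "x \<in> grad V p" "i \<in> I" "g i \<noteq> p"
    using that by blast
qed

lemma graded_eqI:
  assumes "has_gbasis V I e c g r" "p \<in> M" "linear_map V W f" "linear_map V W h"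
    and "\<And>i. i \<in> I \<Longrightarrow> g i = p \<Longrightarrow> f (e i) = h (e i)" and "x \<in> grad V p"
  shows "f x = h x"
  by (rule linear_map_eq_on_span[OF has_gbasisD(7)[OF assms(1)] assms(3,4), of "e ` {i\<in>I. g i = p}"])
    (use assms has_gbasisD(3)[OF assms(1,2)] has_gbasisD(8)[OF assms(1)] in auto)

lemma is_objectI:
  assumes B: "has_gbasis V I e c g r"
    and gr: "\<And>i u. i \<in> I \<Longrightarrow> u \<in> G \<Longrightarrow> g (r i u) = g i \<lhd>\<^sub>M u"
    and one: "\<And>i. i \<in> I \<Longrightarrow> r i \<one> = i"
    and mult: "\<And>i u w. i \<in> I \<Longrightarrow> u \<in> G \<Longrightarrow> w \<in> G \<Longrightarrow> r i (u \<otimes> w) = r (r i u) w"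
  shows "is_object V"
  unfolding is_object_def
proof (intro conjI ballI)
  note D = has_gbasisD[OF B] and H = has_basisD[OF has_gbasisD(1)[OF B]]
  interpret module "scl V" by (rule D(9))
  show "fin_dim_cspace V"
    unfolding fin_dim_cspace_def using H(1,2,3) has_basis_span[OF D(1)]
    by (auto simp: is_cspace_def intro!: exI[of _ "e ` I"])
  show "subspace (grad V p)" "grad V p \<subseteq> vecs V" if "p \<in> M" for p
    using grad_props(1,2)[OF B that] by auto
  show "linear_map V V (\<lambda>v. act V v u)" if "u \<in> G" for u by (rule D(4)[OF that])
  show "act V v \<one> = v" if "v \<in> vecs V" for v
    by (rule linear_map_eq_on_basis[OF D(1) D(4) _ _ that, of \<one> "\<lambda>v. v"])
      (auto simp: linear_map_def D(6) one)
  show "act V v (u \<otimes> w) = act V (act V v u) w" if "u \<in> G" "w \<in> G" "v \<in> vecs V" for u w v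
    by (rule linear_map_eq_on_basis[OF D(1) D(4) linear_map_comp[OF D(4) D(4)] _ that(3)])
      (use that in \<open>auto simp: D(5,6) mult\<close>)
  show "act V v u \<in> grad V (p \<lhd>\<^sub>M u)" if "p \<in> M" "u \<in> G" "v \<in> grad V p" for p u v
    by (rule linear_map_into_span[OF D(7) D(4) _ D(7) grad_props(1)[OF B], of u "e ` {i\<in>I. g i = p}"])
      (use that grad_props(3)[OF B] in \<open>auto simp: D(5,6,8) D(3)[of p] gr\<close>)
  show "\<exists>!f. f \<in> (\<Pi>\<^sub>E p\<in>M. grad V p) \<and> v = (\<Sum>p\<in>M. f p)" if v: "v \<in> vecs V" for v
  proof (rule ex1I)
    let ?f = "\<lambda>p\<in>M. \<Sum>i\<in>{i\<in>I. g i = p}. scl V (c v i) (e i)"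
    have "(\<Sum>p\<in>M. ?f p) = (\<Sum>i\<in>I. scl V (c v i) (e i))"
      using sum.group[OF H(2) finite_MG(1), of g "\<lambda>i. scl V (c v i) (e i)"] D(2) by auto
    moreover have "?f p \<in> grad V p" if "p \<in> M" for p
      using that grad_props(3)[OF B] by (auto simp: D(3) intro!: span_sum span_scale)
    ultimately show "?f \<in> (\<Pi>\<^sub>E p\<in>M. grad V p) \<and> v = (\<Sum>p\<in>M. ?f p)"
      using H(8)[OF v] by auto
    fix f assume f: "f \<in> (\<Pi>\<^sub>E p\<in>M. grad V p) \<and> v = (\<Sum>p\<in>M. f p)"
    then have fg: "f p \<in> grad V p" "f p \<in> vecs V" if "p \<in> M" for p
      using that grad_props(2)[OF B that] by auto
    \<comment> \<open>Components of other grades have coordinate 0 at \<open>i\<close>, so this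
      coordinate of \<open>v\<close> is that of the component of grade \<open>g i\<close>. This
      forces uniqueness of the decomposition.\<close>
    have cv: "c v i = c (f (g i)) i" if i: "i \<in> I" for i
    proof -
      have "c v i = (\<Sum>p\<in>M. c (f p) i)"
        using f coord_sum[OF D(1) i, of M f] fg by auto
      also have "\<dots> = (\<Sum>p\<in>M. if p = g i then c (f p) i else 0)"
        using grad_props(4)[OF B] fg i by (intro sum.cong) auto
      also have "\<dots> = c (f (g i)) i"
        using finite_MG(1) D(2)[OF i] by simp
      finally show ?thesis .
    qed
    show "f = ?f"
    proof (rule extensionalityI[of _ M])
      fix p assume p: "p \<in> M"
      have "f p = (\<Sum>i\<in>I. scl V (c (f p) i) (e i))" using H(8) fg(2)[OF p] by simp
      also have "\<dots> = (\<Sum>i\<in>{i\<in>I. g i = p}. scl V (c (f p) i) (e i))"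
        using grad_props(4)[OF B p fg(1)[OF p]] H(2) by (intro sum.mono_neutral_right) auto
      also have "\<dots> = ?f p" using p cv by (auto intro!: sum.cong)
      finally show "f p = ?f p" .
    qed (use f in \<open>auto simp: PiE_def\<close>)
  qed
qed

text \<open>The images of basis vectors are arbitrary vectors here, since products may vanish and
  the unit is a sum.\<close>

lemma hom_setI:
  assumes B: "has_gbasis V I e c g r" and W: "has_gbasis W J f d k q"
    and h: "h \<in> extensional (vecs V)" "linear_map V W h"
    and gr: "\<And>i. i \<in> I \<Longrightarrow> h (e i) \<in> grad W (g i)"
    and act: "\<And>i u. i \<in> I \<Longrightarrow> u \<in> G \<Longrightarrow> h (e (r i u)) = act W (h (e i)) u"
  shows "h \<in> hom_set V W"
proof -
  note D = has_gbasisD[OF B] and E = has_gbasisD[OF W]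
  have "h v \<in> grad W p" if "p \<in> M" "v \<in> grad V p" for p v
    by (rule linear_map_into_span[OF D(7) h(2) _ E(7) grad_props(1)[OF W], of "e ` {i\<in>I. g i = p}"])
      (use that gr in \<open>auto simp: D(3,8)\<close>)
  moreover have "h (act V v u) = act W (h v) u" if "u \<in> G" "v \<in> vecs V" for u v
    by (rule linear_map_eq_on_basis[OF D(1) linear_map_comp[OF D(4) h(2)]
          linear_map_comp[OF h(2) E(4)] _ that(2)])
      (use that in \<open>auto simp: D(6) act\<close>)
  ultimately show ?thesis using h by (simp add: hom_set_def)
qed


section \<open>Tensor products of objects with homogeneous bases\<close>

lemma tensor_simps [simp]:
  "vecs (tensor V W) = vecs (tensor_space V W)"
  "scl (tensor V W) = fun_scale"
  "linear_map (tensor V W) U f \<longleftrightarrow> linear_map (tensor_space V W) U f"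
  "linear_map U (tensor V W) h \<longleftrightarrow> linear_map U (tensor_space V W) h"
  "is_cspace (tensor V W)"
  "has_basis (tensor V W) I e c \<longleftrightarrow> has_basis (tensor_space V W) I e c"
  using is_cspace_tensor_space[of V W]
  by (simp_all add: tensor_def linear_map_def is_cspace_def has_basis_def)

text \<open>The grade components are spanned by tensors of arbitrary homogeneous vectors, and the
  action is prescribed for a homogeneous second factor, whose grade enters the action on the first.
  Both are reduced to basis vectors by extending in one factor at a time.\<close>

lemma has_gbasis_tensor:
  assumes V: "has_gbasis V I e c g r" and W: "has_gbasis W J f d k q"
  shows "has_gbasis (tensor V W) (I \<times> J) (\<lambda>(i, j). ptens V W (e i) (f j)) (tensor_coord c d)
    (\<lambda>(i, j). g i \<odot> k j) (\<lambda>(i, j) u. (r i (k j \<rhd> u), q j u))"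
proof -
  note v = has_gbasisD[OF V] and w = has_gbasisD[OF W]
  note T = has_basis_tensor_space[OF v(1) w(1)]
  interpret T: module fun_scale by (rule module_fun_scale)
  let ?e = "\<lambda>(i, j). ptens V W (e i) (f j)"
  have grad: "grad (tensor V W) p = T.span (?e ` {ij \<in> I \<times> J. (case ij of (i, j) \<Rightarrow> g i \<odot> k j) = p})"
    (is "?L = ?R") if p: "p \<in> M" for p
  proof
    let ?S = "{ptens V W \<xi> \<eta> | \<xi> \<eta> a b. a \<in> M \<and> b \<in> M \<and> a \<odot> b = p \<and> \<xi> \<in> grad V a \<and> \<eta> \<in> grad W b}"
    have L: "?L = T.span ?S" by (simp add: tensor_def)
    show "?R \<subseteq> ?L"
      unfolding L
    proof (rule T.span_mono, clarify)
      fix i j assume "i \<in> I" "j \<in> J" "p = g i \<odot> k j"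
      then show "\<exists>\<xi> \<eta> a b. ptens V W (e i) (f j) = ptens V W \<xi> \<eta> \<and> a \<in> M \<and> b \<in> M \<and>
          a \<odot> b = g i \<odot> k j \<and> \<xi> \<in> grad V a \<and> \<eta> \<in> grad W b"
        using grad_props(3)[OF V v(2)] grad_props(3)[OF W w(2)] v(2) w(2) by blast
    qed
    have "ptens V W \<xi> \<eta> \<in> ?R"
      if ab: "a \<in> M" "b \<in> M" "a \<odot> b = p" and \<xi>: "\<xi> \<in> grad V a" and \<eta>: "\<eta> \<in> grad W b" for \<xi> \<eta> a b
    proof -
      have 1: "ptens V W \<xi> (f j) \<in> ?R" if j: "j \<in> J" "k j = b" for j
        by (rule linear_map_into_span[OF v(7) linear_map_ptens_left _ is_cspace_tensor_space, of _ _ "e ` {i\<in>I. g i = a}"])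
          (use ab \<xi> j v(3,8) w(8) in \<open>auto intro!: T.span_base\<close>)
      show ?thesis
        by (rule linear_map_into_span[OF w(7) linear_map_ptens_right _ is_cspace_tensor_space, of _ _ "f ` {j\<in>J. k j = b}"])
          (use ab \<xi> \<eta> 1 w(3,8) grad_props(2)[OF V ab(1)] in auto)
    qed
    then show "?L \<subseteq> ?R"
      unfolding L by (intro T.span_minimal) auto
  qed
  have act: "linear_map (tensor_space V W) (tensor_space V W) (\<lambda>t. act (tensor V W) t u) \<and>
      (\<forall>(i, j)\<in>I \<times> J. act (tensor V W) (ptens V W (e i) (f j)) u = ptens V W (e (r i (k j \<rhd> u))) (f (q j u)))"
    if u: "u \<in> G" for u
  proof -
    let ?P = "\<lambda>h. \<forall>b\<in>M. \<forall>\<xi>\<in>vecs V. \<forall>\<eta>\<in>grad W b.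
      h (ptens V W \<xi> \<eta>) = ptens V W (act V \<xi> (b \<rhd> u)) (act W \<eta> u)"
    let ?\<phi> = "\<lambda>(i, j). ptens V W (e (r i (k j \<rhd> u))) (f (q j u))"
    have P: "?P h \<longleftrightarrow> (\<forall>ij\<in>I \<times> J. h (?e ij) = ?\<phi> ij)"
      if h: "linear_map (tensor_space V W) (tensor_space V W) h" for h
    proof
      assume R: "\<forall>ij\<in>I \<times> J. h (?e ij) = ?\<phi> ij"
      show "?P h"
      proof (intro ballI)
        fix b x y assume b: "b \<in> M" and x: "x \<in> vecs V" and y: "y \<in> grad W b"
        have bu: "b \<rhd> u \<in> G" using b u by simp
        show "h (ptens V W x y) = ptens V W (act V x (b \<rhd> u)) (act W y u)"
        proof (rule bilinear_eq_on_span[OF v(7) w(7), where S = "e ` I" and T = "f ` {j\<in>J. k j = b}"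
              and U = "tensor_space V W" and F = "\<lambda>x y. h (ptens V W x y)"
              and H = "\<lambda>x y. ptens V W (act V x (b \<rhd> u)) (act W y u)"])
          show "linear_map V (tensor_space V W) (\<lambda>x. h (ptens V W x y))" if "y \<in> vecs W" for y
            by (rule linear_map_comp[OF linear_map_ptens_left[OF that] h])
          show "linear_map W (tensor_space V W) (\<lambda>y. h (ptens V W x y))" if "x \<in> vecs V" for x
            by (rule linear_map_comp[OF linear_map_ptens_right[OF that] h])
          show "linear_map V (tensor_space V W) (\<lambda>x. ptens V W (act V x (b \<rhd> u)) (act W y u))"
            if "y \<in> vecs W" for y
            using linear_map_comp[OF v(4)[OF bu] linear_map_ptens_left] linear_mapD(1)[OF w(4)[OF u]] that
            by blast
          show "linear_map W (tensor_space V W) (\<lambda>y. ptens V W (act V x (b \<rhd> u)) (act W y u))"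
            if "x \<in> vecs V" for x
            using linear_map_comp[OF w(4)[OF u] linear_map_ptens_right] linear_mapD(1)[OF v(4)[OF bu]] that
            by blast
        qed (use R u b bu x y in \<open>auto simp: has_basis_span[OF v(1)] v(6,8) w(3,6,8)\<close>)
      qed
    next
      assume L: "?P h"
      have "h (ptens V W (e i) (f j)) = ?\<phi> (i, j)" if "i \<in> I" "j \<in> J" for i j
        using L[rule_format, OF w(2)[OF that(2)] v(8)[OF that(1)] grad_props(3)[OF W w(2)[OF that(2)] that(2) refl]]
          that u by (simp add: v(2,6) w(2,6))
      then show "\<forall>ij\<in>I \<times> J. h (?e ij) = ?\<phi> ij" by auto
    qed
    have im: "?\<phi> ij \<in> vecs (tensor_space V W)" if "ij \<in> I \<times> J" for ij
      using that u by (auto intro!: ptens_in_tensor_space v(5,8) w(2,5,8) operations_closed)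
    note * = the_linear_map_basis[OF T is_cspace_tensor_space im P]
    show ?thesis
      using *(1) *(4) by (auto simp: tensor_def)
  qed
  show ?thesis
    unfolding has_gbasis_def using T grad act v(2,5) w(2,5) by auto
qed


section \<open>Conjugate objects\<close>

lemma bar_simps [simp]:
  "vecs (bar V) = vecs V"
  "scl (bar V) c v = scl V (cnj c) v"
  "linear_map (bar V) (bar W) f \<longleftrightarrow> linear_map V W f"
proof -
  \<comment> \<open>A scalar in one condition corresponds to its conjugate in the other.\<close>
  show "linear_map (bar V) (bar W) f \<longleftrightarrow> linear_map V W f"
    unfolding linear_map_def bar_def by (auto, metis complex_cnj_cnj)
qed (simp_all add: bar_def)

lemma is_cspace_bar [simp]:
  assumes "is_cspace V"
  shows "is_cspace (bar V)"
proof -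
  interpret V: module "scl V" using assms by (rule is_cspace_module)
  interpret W: module "scl (bar V)"
    by unfold_locales (auto simp: V.scale_left_distrib V.scale_right_distrib)
  show ?thesis
    using assms W.module_axioms
    by (auto simp: is_cspace_def module_iff_vector_space[symmetric] V.subspace_def W.subspace_def)
qed

lemma span_bar:
  assumes "is_cspace V"
  shows "module.span (scl (bar V)) S = module.span (scl V) S"
proof -
  interpret V: module "scl V" using assms by (rule is_cspace_module)
  interpret W: module "scl (bar V)" using is_cspace_bar[OF assms] by (rule is_cspace_module)
  have "V.subspace T \<longleftrightarrow> W.subspace T" for T
    by (simp add: V.subspace_def W.subspace_def) (metis complex_cnj_cnj)
  then have "V.subspace = W.subspace" by blast
  then show ?thesis by (simp add: V.span_def W.span_def)
qed

text \<open>The conjugate scalar multiplication conjugates a coefficient once more, so conjugated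
  coordinates give back the same expansion.\<close>

lemma has_basis_bar:
  assumes "has_basis V I e c"
  shows "has_basis (bar V) I e (\<lambda>x i. cnj (c x i))"
  using assms unfolding has_basis_def by auto

text \<open>The component of grade \<open>p\<close> of the conjugate is the component of grade
  \<open>linv p\<close> of \<open>V\<close>, by mutual inversion of \<open>rinv\<close> and
  \<open>linv\<close>.\<close>

lemma has_gbasis_bar:
  assumes V: "has_gbasis V I e c g r"
  shows "has_gbasis (bar V) I e (\<lambda>x i. cnj (c x i)) (\<lambda>i. rinv (g i)) (\<lambda>i u. r i (rinv (g i) \<rhd> u))"
proof -
  note v = has_gbasisD[OF V]
  have grad: "grad (bar V) p = module.span (scl V) (e ` {i\<in>I. rinv (g i) = p})" if p: "p \<in> M" for p
  proof -
    have "grad (bar V) p = grad V (linv p)"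
      using p by (auto simp: bar_def rinv_eq_iff)
    moreover have "{i\<in>I. rinv (g i) = p} = {i\<in>I. g i = linv p}"
      using p v(2) by (auto simp: rinv_eq_iff)
    ultimately show ?thesis using v(3)[OF linv_closed[OF p]] by simp
  qed
  have act: "linear_map V V (\<lambda>x. act (bar V) x u) \<and>
      (\<forall>i\<in>I. act (bar V) (e i) u = e (r i (rinv (g i) \<rhd> u)))" if u: "u \<in> G" for u
  proof -
    let ?P = "\<lambda>h. \<forall>p\<in>M. \<forall>x\<in>grad V p. h x = act V x (rinv p \<rhd> u)"
    have P: "?P h \<longleftrightarrow> (\<forall>i\<in>I. h (e i) = e (r i (rinv (g i) \<rhd> u)))" if h: "linear_map V V h" for h
    proof
      assume L: "?P h"
      show "\<forall>i\<in>I. h (e i) = e (r i (rinv (g i) \<rhd> u))"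
      proof
        fix i assume i: "i \<in> I"
        show "h (e i) = e (r i (rinv (g i) \<rhd> u))"
          using L[rule_format, OF v(2)[OF i] grad_props(3)[OF V v(2)[OF i] i refl]] i u
          by (simp add: v(2,6))
      qed
    next
      assume R: "\<forall>i\<in>I. h (e i) = e (r i (rinv (g i) \<rhd> u))"
      show "?P h"
      proof (intro ballI)
        fix p x assume p: "p \<in> M" and x: "x \<in> grad V p"
        show "h x = act V x (rinv p \<rhd> u)"
          by (rule graded_eqI[OF V p h v(4) _ x]) (use R p u v(6) in auto)
      qed
    qed
    have im: "e (r i (rinv (g i) \<rhd> u)) \<in> vecs V" if "i \<in> I" for i
      using that u v(2,5,8) by simp
    note * = the_linear_map_basis[OF v(1) v(7) im P]
    show ?thesis using *(1) *(4) by (auto simp: bar_def)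
  qed
  show ?thesis
    unfolding has_gbasis_def span_bar[OF v(7)]
    using has_basis_bar[OF v(1)] grad act v(2,5) by auto
qed


section \<open>The structure maps on bases\<close>

lemma bb_basis:
  assumes V: "has_gbasis V I e c g r"
  shows "linear_map V (bar (bar V)) (bb V)" "bb V \<in> extensional (vecs V)"
    and "i \<in> I \<Longrightarrow> bb V (e i) = e (r i (inv (tau (linv (g i)) (g i))))"
proof -
  note v = has_gbasisD[OF V]
  let ?P = "\<lambda>h. \<forall>p\<in>M. \<forall>v\<in>grad V p. h v = act V v (inv (tau (linv p) p))"
  let ?\<phi> = "\<lambda>i. e (r i (inv (tau (linv (g i)) (g i))))"
  \<comment> \<open>Conjugating twice restores the scalars.\<close>
  have lin: "linear_map V (bar (bar V)) f \<longleftrightarrow> linear_map V V f" for f :: "'a \<Rightarrow> 'a"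
    by (simp add: linear_map_def)
  have P: "?P h \<longleftrightarrow> (\<forall>i\<in>I. h (e i) = ?\<phi> i)" if h: "linear_map V (bar (bar V)) h" for h
  proof
    assume L: "?P h"
    show "\<forall>i\<in>I. h (e i) = ?\<phi> i"
    proof
      fix i assume i: "i \<in> I"
      show "h (e i) = ?\<phi> i"
        using L[rule_format, OF v(2)[OF i] grad_props(3)[OF V v(2)[OF i] i refl]] i
        by (simp add: v(2,6))
    qed
  next
    assume R: "\<forall>i\<in>I. h (e i) = ?\<phi> i"
    show "?P h"
    proof (intro ballI)
      fix p x assume p: "p \<in> M" and x: "x \<in> grad V p"
      show "h x = act V x (inv (tau (linv p) p))"
        by (rule graded_eqI[OF V p h[unfolded lin] v(4) _ x]) (use R p v(6) in auto)
    qed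
  qed
  have im: "?\<phi> i \<in> vecs (bar (bar V))" if "i \<in> I" for i
    using that v(2,5,8) by simp
  note * = the_linear_map_basis[OF v(1) is_cspace_bar[OF is_cspace_bar[OF v(7)]] im P, folded bb_def]
  show "linear_map V (bar (bar V)) (bb V)" "bb V \<in> extensional (vecs V)"
    and "i \<in> I \<Longrightarrow> bb V (e i) = ?\<phi> i"
    using * by auto
qed

lemma upsilon_inv_basis:
  assumes W: "has_gbasis W J f d k q" and V: "has_gbasis V I e c g r"
  shows "linear_map (tensor_space (bar V) (bar W)) (bar (tensor W V)) (upsilon_inv W V)"
    and "upsilon_inv W V \<in> extensional (vecs (tensor_space (bar V) (bar W)))"
    and "i \<in> I \<Longrightarrow> j \<in> J \<Longrightarrow> upsilon_inv W V (ptens (bar V) (bar W) (e i) (f j)) =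
      act (tensor W V) (ptens W V (f (q j (inv (tau (g i) (rinv (g i)))))) (e i))
        (tau (rinv (g i)) (rinv (k j)))"
proof -
  note v = has_gbasisD[OF V] and w = has_gbasisD[OF W]
    and t = has_gbasisD[OF has_gbasis_tensor[OF W V]]
  let ?P = "\<lambda>h. \<forall>a\<in>M. \<forall>b\<in>M. \<forall>v\<in>grad V a. \<forall>w\<in>grad W b. h (ptens (bar V) (bar W) v w) =
    act (tensor W V) (ptens W V (act W w (inv (tau a (rinv a)))) v) (tau (rinv a) (rinv b))"
  let ?\<phi> = "\<lambda>(i, j). act (tensor W V) (ptens W V (f (q j (inv (tau (g i) (rinv (g i)))))) (e i))
        (tau (rinv (g i)) (rinv (k j)))"
  let ?e = "\<lambda>(i, j). ptens (bar V) (bar W) (e i) (f j)"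
  have P: "?P h \<longleftrightarrow> (\<forall>ij\<in>I \<times> J. h (?e ij) = ?\<phi> ij)"
    if h: "linear_map (tensor (bar V) (bar W)) (bar (tensor W V)) h" for h
  proof
    assume L: "?P h"
    have "h (?e (i, j)) = ?\<phi> (i, j)" if i: "i \<in> I" and j: "j \<in> J" for i j
      using L[rule_format, OF v(2)[OF i] w(2)[OF j] grad_props(3)[OF V v(2)[OF i] i refl]
          grad_props(3)[OF W w(2)[OF j] j refl]] i j
      by (simp add: v(2) w(6))
    then show "\<forall>ij\<in>I \<times> J. h (?e ij) = ?\<phi> ij" by auto
  next
    assume R: "\<forall>ij\<in>I \<times> J. h (?e ij) = ?\<phi> ij"
    show "?P h"
    proof (intro ballI)
      fix a b x y assume a: "a \<in> M" and b: "b \<in> M" and x: "x \<in> grad V a" and y: "y \<in> grad W b"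
      define s where "s = inv (tau a (rinv a))"
      define z where "z = tau (rinv a) (rinv b)"
      have sz: "s \<in> G" "z \<in> G" using a b by (auto simp: s_def z_def)
      have h': "linear_map (tensor_space (bar V) (bar W)) (bar (tensor W V)) h"
        using h by simp
      have act_z: "linear_map (tensor_space W V) (tensor W V) (\<lambda>x. act (tensor W V) x z)"
        using t(4)[OF sz(2)] by simp
      have "h (ptens (bar V) (bar W) x y) = act (tensor W V) (ptens W V (act W y s) x) z"
      proof (rule bilinear_eq_on_span[OF v(7) w(7), where S = "e ` {i\<in>I. g i = a}"
              and T = "f ` {j\<in>J. k j = b}" and U = "tensor W V"
              and F = "\<lambda>x y. h (ptens (bar V) (bar W) x y)"
              and H = "\<lambda>x y. act (tensor W V) (ptens W V (act W y s) x) z"])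
        \<comment> \<open>A linear map from one conjugate to another is also linear for the original
          scalars, so the bilinear extension can be run over \<open>V\<close>, \<open>W\<close> and
          \<open>tensor W V\<close>.\<close>
        show "linear_map V (tensor W V) (\<lambda>x. h (ptens (bar V) (bar W) x y))" if "y \<in> vecs W" for y
          by (subst bar_simps(3)[symmetric], rule linear_map_comp[OF linear_map_ptens_left h'])
            (use that in simp)
        show "linear_map W (tensor W V) (\<lambda>y. h (ptens (bar V) (bar W) x y))" if "x \<in> vecs V" for x
          by (subst bar_simps(3)[symmetric], rule linear_map_comp[OF linear_map_ptens_right h'])
            (use that in simp)
        show "linear_map V (tensor W V) (\<lambda>x. act (tensor W V) (ptens W V (act W y s) x) z)"
          if "y \<in> vecs W" for y
          by (rule linear_map_comp[OF linear_map_ptens_right act_z])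
            (rule linear_mapD(1)[OF w(4)[OF sz(1)] that])
        show "linear_map W (tensor W V) (\<lambda>y. act (tensor W V) (ptens W V (act W y s) x) z)"
          if "x \<in> vecs V" for x
          by (rule linear_map_comp[OF linear_map_comp[OF w(4)[OF sz(1)] linear_map_ptens_left[OF that]] act_z])
      qed (use R sz a b x y v(3,8) w(3,8) in \<open>auto simp: w(6) s_def z_def\<close>)
      then show "h (ptens (bar V) (bar W) x y) =
          act (tensor W V) (ptens W V (act W y (inv (tau a (rinv a)))) x) (tau (rinv a) (rinv b))"
        by (simp add: s_def z_def)
    qed
  qed
  have im: "?\<phi> ij \<in> vecs (bar (tensor W V))" if "ij \<in> I \<times> J" for ij
  proof -
    obtain i j where ij: "ij = (i, j)" "i \<in> I" "j \<in> J" using \<open>ij \<in> I \<times> J\<close> by auto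
    then have "ptens W V (f (q j (inv (tau (g i) (rinv (g i)))))) (e i) \<in> vecs (tensor W V)"
      using v(2,8) w(5,8) by (simp add: ptens_in_tensor_space)
    from linear_mapD(1)[OF t(4) this, of "tau (rinv (g i)) (rinv (k j))"] show ?thesis
      using ij v(2) w(2) by simp
  qed
  have B: "has_basis (tensor (bar V) (bar W)) (I \<times> J) ?e
      (tensor_coord (\<lambda>x i. cnj (c x i)) (\<lambda>x i. cnj (d x i)))"
    using has_basis_tensor_space[OF has_basis_bar[OF v(1)] has_basis_bar[OF w(1)]] by simp
  note * = the_linear_map_basis[OF B is_cspace_bar[OF tensor_simps(5)] im P, folded upsilon_inv_def]
  show "linear_map (tensor_space (bar V) (bar W)) (bar (tensor W V)) (upsilon_inv W V)"
    and "upsilon_inv W V \<in> extensional (vecs (tensor_space (bar V) (bar W)))"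
    and "i \<in> I \<Longrightarrow> j \<in> J \<Longrightarrow> upsilon_inv W V (ptens (bar V) (bar W) (e i) (f j)) =
      act (tensor W V) (ptens W V (f (q j (inv (tau (g i) (rinv (g i)))))) (e i))
        (tau (rinv (g i)) (rinv (k j)))"
    using *(1,2) *(4)[of "(i, j)"] by auto
qed

text \<open>The prescription is trilinear, with two arguments homogeneous. It is extended over the
  first two vectors with a basis vector in third place, then over the third within its
  grade.\<close>

lemma associator_basis:
  assumes V: "has_gbasis V I e c g r" and W: "has_gbasis W J f d k q" and Z: "has_gbasis Z L b m l s"
  shows "linear_map (tensor_space (tensor V W) Z) (tensor_space V (tensor W Z)) (associator V W Z)"
    and "associator V W Z \<in> extensional (vecs (tensor_space (tensor V W) Z))"
    and "i \<in> I \<Longrightarrow> j \<in> J \<Longrightarrow> n \<in> L \<Longrightarrow>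
      associator V W Z (ptens (tensor V W) Z (ptens V W (e i) (f j)) (b n)) =
      ptens V (tensor W Z) (e (r i (tau (k j) (l n)))) (ptens W Z (f j) (b n))"
proof -
  note v = has_gbasisD[OF V] and w = has_gbasisD[OF W] and z = has_gbasisD[OF Z]
  let ?P = "\<lambda>h. \<forall>q\<in>M. \<forall>r\<in>M. \<forall>\<xi>\<in>vecs V. \<forall>\<eta>\<in>grad W q. \<forall>\<zeta>\<in>grad Z r.
          h (ptens (tensor V W) Z (ptens V W \<xi> \<eta>) \<zeta>) =
            ptens V (tensor W Z) (act V \<xi> (tau q r)) (ptens W Z \<eta> \<zeta>)"
  let ?\<phi> = "\<lambda>((i, j), n). ptens V (tensor W Z) (e (r i (tau (k j) (l n)))) (ptens W Z (f j) (b n))"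
  let ?e = "\<lambda>(ij, n). ptens (tensor V W) Z (case ij of (i, j) \<Rightarrow> ptens V W (e i) (f j)) (b n)"
  have P: "?P h \<longleftrightarrow> (\<forall>ij\<in>(I \<times> J) \<times> L. h (?e ij) = ?\<phi> ij)"
    if h0: "linear_map (tensor (tensor V W) Z) (tensor V (tensor W Z)) h" for h
  proof
    assume H: "?P h"
    have "h (?e ((i, j), n)) = ?\<phi> ((i, j), n)" if i: "i \<in> I" and j: "j \<in> J" and n: "n \<in> L" for i j n
      using H[rule_format, OF w(2)[OF j] z(2)[OF n] v(8)[OF i] grad_props(3)[OF W w(2)[OF j] j refl]
          grad_props(3)[OF Z z(2)[OF n] n refl]] i j n
      by (simp add: v(6) w(2) z(2))
    then show "\<forall>ij\<in>(I \<times> J) \<times> L. h (?e ij) = ?\<phi> ij" by auto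
  next
    assume R: "\<forall>ij\<in>(I \<times> J) \<times> L. h (?e ij) = ?\<phi> ij"
    have h: "linear_map (tensor_space (tensor V W) Z) (tensor_space V (tensor W Z)) h"
      using h0 by simp
    show "?P h"
    proof (intro ballI)
      fix a a' x y y' assume a: "a \<in> M" "a' \<in> M"
        and x: "x \<in> vecs V" and y: "y \<in> grad W a" and y': "y' \<in> grad Z a'"
      define u where "u = tau a a'"
      have u: "u \<in> G" using a by (simp add: u_def)
      have yW: "y \<in> vecs W" using grad_props(2)[OF W a(1)] y by blast
      have VW: "linear_map V (tensor V W) (\<lambda>x. ptens V W x y)" if "y \<in> vecs W" for y
        using linear_map_ptens_left[OF that, of V] by simp
      have VW': "linear_map W (tensor V W) (ptens V W x)" if "x \<in> vecs V" for x
        using linear_map_ptens_right[OF that, of W] by simp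
      have WZ: "linear_map W (tensor W Z) (\<lambda>x. ptens W Z x y)" if "y \<in> vecs Z" for y
        using linear_map_ptens_left[OF that, of W] by simp
      have WZ': "linear_map Z (tensor W Z) (ptens W Z x)" if "x \<in> vecs W" for x
        using linear_map_ptens_right[OF that, of Z] by simp
      let ?U = "tensor_space V (tensor W Z)"
      have 1: "h (ptens (tensor V W) Z (ptens V W x y) (b n)) =
          ptens V (tensor W Z) (act V x u) (ptens W Z y (b n))" if n: "n \<in> L" "l n = a'" for n
      proof (rule bilinear_eq_on_span[OF v(7) w(7), where S = "e ` I" and T = "f ` {j\<in>J. k j = a}"
              and U = "?U" and F = "\<lambda>x y. h (ptens (tensor V W) Z (ptens V W x y) (b n))"
              and H = "\<lambda>x y. ptens V (tensor W Z) (act V x u) (ptens W Z y (b n))"])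
        show "linear_map V ?U (\<lambda>x. h (ptens (tensor V W) Z (ptens V W x y) (b n)))" if "y \<in> vecs W" for y
          by (rule linear_map_comp[OF linear_map_comp[OF VW[OF that] linear_map_ptens_left[OF z(8)[OF n(1)]]] h])
        show "linear_map W ?U (\<lambda>y. h (ptens (tensor V W) Z (ptens V W x y) (b n)))" if "x \<in> vecs V" for x
          by (rule linear_map_comp[OF linear_map_comp[OF VW'[OF that] linear_map_ptens_left[OF z(8)[OF n(1)]]] h])
        show "linear_map V ?U (\<lambda>x. ptens V (tensor W Z) (act V x u) (ptens W Z y (b n)))" if "y \<in> vecs W" for y
          by (rule linear_map_comp[OF v(4)[OF u] linear_map_ptens_left])
            (use that z(8)[OF n(1)] in \<open>simp add: ptens_in_tensor_space\<close>)
        show "linear_map W ?U (\<lambda>y. ptens V (tensor W Z) (act V x u) (ptens W Z y (b n)))" if "x \<in> vecs V" for x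
          by (rule linear_map_comp[OF WZ[OF z(8)[OF n(1)]] linear_map_ptens_right])
            (rule linear_mapD(1)[OF v(4)[OF u] that])
      qed (use R n u x y v(8) w(3,8) a in \<open>auto simp: has_basis_span[OF v(1)] v(6) u_def\<close>)
      show "h (ptens (tensor V W) Z (ptens V W x y) y') =
          ptens V (tensor W Z) (act V x (tau a a')) (ptens W Z y y')"
        unfolding u_def[symmetric]
      proof (rule graded_eqI[OF Z a(2), where f = "\<lambda>y'. h (ptens (tensor V W) Z (ptens V W x y) y')"
              and h = "\<lambda>y'. ptens V (tensor W Z) (act V x u) (ptens W Z y y')"])
        show "linear_map Z ?U (\<lambda>y'. h (ptens (tensor V W) Z (ptens V W x y) y'))"
          by (rule linear_map_comp[OF linear_map_ptens_right h])
            (use x yW in \<open>simp add: ptens_in_tensor_space\<close>)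
        show "linear_map Z ?U (\<lambda>y'. ptens V (tensor W Z) (act V x u) (ptens W Z y y'))"
          by (rule linear_map_comp[OF WZ'[OF yW] linear_map_ptens_right])
            (rule linear_mapD(1)[OF v(4)[OF u] x])
      qed (use 1 y' in auto)
    qed
  qed
  have im: "?\<phi> ij \<in> vecs (tensor V (tensor W Z))" if "ij \<in> (I \<times> J) \<times> L" for ij
    using that by (auto intro!: ptens_in_tensor_space v(5,8) w(2,8) z(2,8) operations_closed)
  have B: "has_basis (tensor (tensor V W) Z) ((I \<times> J) \<times> L) ?e (tensor_coord (tensor_coord c d) m)"
    using has_basis_tensor_space[OF has_gbasisD(1)[OF has_gbasis_tensor[OF V W]] z(1)] by simp
  note * = the_linear_map_basis[OF B tensor_simps(5) im P, folded associator_def]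
  show "linear_map (tensor_space (tensor V W) Z) (tensor_space V (tensor W Z)) (associator V W Z)"
    and "associator V W Z \<in> extensional (vecs (tensor_space (tensor V W) Z))"
    and "i \<in> I \<Longrightarrow> j \<in> J \<Longrightarrow> n \<in> L \<Longrightarrow>
      associator V W Z (ptens (tensor V W) Z (ptens V W (e i) (f j)) (b n)) =
      ptens V (tensor W Z) (e (r i (tau (k j) (l n)))) (ptens W Z (f j) (b n))"
    using *(1,2) *(4)[of "((i, j), n)"] by auto
qed

section \<open>The unit object and the unitors\<close>

lemma unit_simps [simp]:
  "vecs unit_object = UNIV" "scl unit_object = (*)"
  by (simp_all add: unit_object_def)

lemma has_gbasis_unit:
  "has_gbasis unit_object {()} (\<lambda>_. 1) (\<lambda>z _. z) (\<lambda>_. \<one>) (\<lambda>_ _. ())"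
proof -
  interpret C: vector_space "(*) :: complex \<Rightarrow> complex \<Rightarrow> complex"
    by unfold_locales (auto simp: algebra_simps)
  have "z \<in> C.span {1}" for z
    using C.span_scale[OF C.span_base[of 1 "{1}"], of z] by simp
  then have "C.span {1} = UNIV" by auto
  then show ?thesis
    using C.vector_space_axioms one_in_M
    by (auto simp: has_gbasis_def has_basis_def is_cspace_def linear_map_def unit_object_def)
qed

lemma left_unitor_basis:
  assumes V: "has_basis V I e c"
  shows "linear_map (tensor_space unit_object V) V (left_unitor V)"
    and "left_unitor V \<in> extensional (vecs (tensor_space unit_object V))"
    and "i \<in> I \<Longrightarrow> left_unitor V (ptens unit_object V 1 (e i)) = e i"
proof -
  note D = has_basisD[OF V] and U = has_gbasisD[OF has_gbasis_unit]
  interpret module "scl V" using D(1) by (rule is_cspace_module)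
  let ?P = "\<lambda>h. \<forall>z. \<forall>v\<in>vecs V. h (ptens unit_object V z v) = scl V z v"
  let ?e = "\<lambda>(i, j). ptens unit_object V ((\<lambda>_. 1) i) (e j)"
  have P: "?P h \<longleftrightarrow> (\<forall>ij\<in>{()} \<times> I. h (?e ij) = e (snd ij))" if h0: "linear_map (tensor unit_object V) V h" for h
  proof
    assume R: "\<forall>ij\<in>{()} \<times> I. h (?e ij) = e (snd ij)"
    have h: "linear_map (tensor_space unit_object V) V h" using h0 by simp
    show "?P h"
    proof (intro allI ballI)
      fix z x assume x: "x \<in> vecs V"
      show "h (ptens unit_object V z x) = scl V z x"
      proof (rule bilinear_eq_on_span[OF U(7) D(1), where S = "(\<lambda>_. 1) ` {()}" and T = "e ` I" and U = V
            and F = "\<lambda>z x. h (ptens unit_object V z x)" and H = "scl V"])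
        show "linear_map unit_object V (\<lambda>z. h (ptens unit_object V z x))" if "x \<in> vecs V" for x
          by (rule linear_map_comp[OF linear_map_ptens_left[OF that] h])
        show "linear_map V V (\<lambda>x. h (ptens unit_object V z x))" for z
          by (rule linear_map_comp[OF linear_map_ptens_right h]) simp
        show "linear_map unit_object V (\<lambda>z. scl V z x)" if "x \<in> vecs V" for x
          using that is_cspace_closed[OF D(1)] by (auto simp: linear_map_def scale_left_distrib)
        show "linear_map V V (scl V z)" for z
          using is_cspace_closed[OF D(1)] by (auto simp: linear_map_def scale_right_distrib mult.commute)
        show "z \<in> module.span (scl unit_object) ((\<lambda>_. 1) ` {()})"
          unfolding has_basis_span[OF U(1)] by simp
      qed (use R x D(4) in \<open>auto simp: has_basis_span[OF V]\<close>)
    qed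
  qed (auto simp: D(4))
  have im: "e (snd ij) \<in> vecs V" if "ij \<in> {()} \<times> I" for ij using that D(4) by auto
  have B: "has_basis (tensor unit_object V) ({()} \<times> I) ?e (tensor_coord (\<lambda>z _. z) c)"
    using has_basis_tensor_space[OF U(1) V] by simp
  note * = the_linear_map_basis[OF B D(1) im P, folded left_unitor_def]
  show "linear_map (tensor_space unit_object V) V (left_unitor V)"
    and "left_unitor V \<in> extensional (vecs (tensor_space unit_object V))"
    and "i \<in> I \<Longrightarrow> left_unitor V (ptens unit_object V 1 (e i)) = e i"
    using *(1,2) *(4)[of "((), i)"] by auto
qed

lemma right_unitor_basis:
  assumes V: "has_basis V I e c"
  shows "linear_map (tensor_space V unit_object) V (right_unitor V)"
    and "right_unitor V \<in> extensional (vecs (tensor_space V unit_object))"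
    and "i \<in> I \<Longrightarrow> right_unitor V (ptens V unit_object (e i) 1) = e i"
proof -
  note D = has_basisD[OF V] and U = has_gbasisD[OF has_gbasis_unit]
  interpret module "scl V" using D(1) by (rule is_cspace_module)
  let ?P = "\<lambda>h. \<forall>z. \<forall>v\<in>vecs V. h (ptens V unit_object v z) = scl V z v"
  let ?e = "\<lambda>(j, i). ptens V unit_object (e j) ((\<lambda>_. 1) i)"
  have P: "?P h \<longleftrightarrow> (\<forall>ij\<in>I \<times> {()}. h (?e ij) = e (fst ij))" if h0: "linear_map (tensor V unit_object) V h" for h
  proof
    assume R: "\<forall>ij\<in>I \<times> {()}. h (?e ij) = e (fst ij)"
    have h: "linear_map (tensor_space V unit_object) V h" using h0 by simp
    show "?P h"
    proof (intro allI ballI)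
      fix z x assume x: "x \<in> vecs V"
      show "h (ptens V unit_object x z) = scl V z x"
      proof (rule bilinear_eq_on_span[OF U(7) D(1), where S = "(\<lambda>_. 1) ` {()}" and T = "e ` I" and U = V
            and F = "\<lambda>z x. h (ptens V unit_object x z)" and H = "scl V"])
        show "linear_map unit_object V (\<lambda>z. h (ptens V unit_object x z))" if "x \<in> vecs V" for x
          by (rule linear_map_comp[OF linear_map_ptens_right[OF that] h])
        show "linear_map V V (\<lambda>x. h (ptens V unit_object x z))" for z
          by (rule linear_map_comp[OF linear_map_ptens_left h]) simp
        show "linear_map unit_object V (\<lambda>z. scl V z x)" if "x \<in> vecs V" for x
          using that is_cspace_closed[OF D(1)] by (auto simp: linear_map_def scale_left_distrib)
        show "linear_map V V (scl V z)" for z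
          using is_cspace_closed[OF D(1)] by (auto simp: linear_map_def scale_right_distrib mult.commute)
        show "z \<in> module.span (scl unit_object) ((\<lambda>_. 1) ` {()})"
          unfolding has_basis_span[OF U(1)] by simp
      qed (use R x D(4) in \<open>auto simp: has_basis_span[OF V]\<close>)
    qed
  qed (auto simp: D(4))
  have im: "e (fst ij) \<in> vecs V" if "ij \<in> I \<times> {()}" for ij using that D(4) by auto
  have B: "has_basis (tensor V unit_object) (I \<times> {()}) ?e (tensor_coord c (\<lambda>z _. z))"
    using has_basis_tensor_space[OF V U(1)] by simp
  note * = the_linear_map_basis[OF B D(1) im P, folded right_unitor_def]
  show "linear_map (tensor_space V unit_object) V (right_unitor V)"
    and "right_unitor V \<in> extensional (vecs (tensor_space V unit_object))"
    and "i \<in> I \<Longrightarrow> right_unitor V (ptens V unit_object (e i) 1) = e i"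
    using *(1,2) *(4)[of "(i, ())"] by auto
qed


section \<open>The algebra \<open>A_bowtie\<close>\<close>

definition ebas :: "'x \<times> 'x \<Rightarrow> 'x \<times> 'x \<Rightarrow> complex" where
  "ebas i = dlt (fst i) (snd i)"

lemma dlt_eq_ebas: "dlt s u = ebas (s, u)"
  by (simp add: ebas_def)

lemma has_basis_A_space: "has_basis A_space (M \<times> G) ebas (\<lambda>f i. f i)"
proof -
  interpret vector_space fun_scale by (rule vector_space_fun_scale)
  have "f = (\<Sum>i\<in>M \<times> G. fun_scale (f i) (ebas i))" if f: "\<forall>x. x \<notin> M \<times> G \<longrightarrow> f x = 0" for f
  proof
    fix x
    have "(\<Sum>i\<in>I. fun_scale (f i) (ebas i)) x = (\<Sum>i\<in>I. if i = x then f i else 0)" for I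
      by (induction I rule: infinite_finite_induct) (auto simp: fun_scale_def ebas_def dlt_def)
    then have "(\<Sum>i\<in>M \<times> G. fun_scale (f i) (ebas i)) x = (\<Sum>i\<in>M \<times> G. if i = x then f i else 0)" .
    also have "\<dots> = f x" using f finite_MG by (cases x) auto
    finally show "f x = (\<Sum>i\<in>M \<times> G. fun_scale (f i) (ebas i)) x" ..
  qed
  moreover have "subspace {f. \<forall>x. x \<notin> M \<times> G \<longrightarrow> f x = 0}"
    by (auto simp: subspace_def fun_scale_def)
  ultimately show ?thesis
    unfolding has_basis_def is_cspace_def
    using vector_space_axioms finite_MG
    by (auto simp: A_space_def ebas_def dlt_def fun_scale_def)
qed

lemma A_bowtie_simps [simp]:
  "vecs A_bowtie = vecs A_space" "scl A_bowtie = fun_scale" "scl A_space = fun_scale"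
  by (simp_all add: A_bowtie_def A_space_def)

lemma has_gbasis_A_bowtie: "has_gbasis A_bowtie (M \<times> G) ebas (\<lambda>f i. f i) gr act_ix"
proof -
  note D = has_basisD[OF has_basis_A_space]
  have lin: "linear_map A_bowtie A_bowtie f \<longleftrightarrow> linear_map A_space A_space f" for f
    by (simp add: linear_map_def)
  have B: "has_basis A_bowtie (M \<times> G) ebas (\<lambda>f i. f i)"
    using has_basis_A_space by (simp add: has_basis_def is_cspace_def)
  have grad: "grad A_bowtie p = module.span fun_scale (ebas ` {i \<in> M \<times> G. gr i = p})" for p
  proof -
    have "{dlt s u | s u. s \<in> M \<and> u \<in> G \<and> A_grade s u = p} = ebas ` {i \<in> M \<times> G. gr i = p}"
      by (auto simp: dlt_eq_ebas gr_def image_iff) blast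
    then show ?thesis by (simp add: A_bowtie_def)
  qed
  have act: "linear_map A_space A_space (\<lambda>f. act A_bowtie f v) \<and>
      (\<forall>i\<in>M \<times> G. act A_bowtie (ebas i) v = ebas (act_ix i v))" if v: "v \<in> G" for v
  proof -
    let ?P = "\<lambda>h. \<forall>s\<in>M. \<forall>u\<in>G. h (dlt s u) =
      (let g = A_grade s u \<rhd> v in dlt (s \<lhd>\<^sub>M g) (inv g \<otimes> u \<otimes> v))"
    have P: "?P h \<longleftrightarrow> (\<forall>i\<in>M \<times> G. h (ebas i) = ebas (act_ix i v))" for h
      by (auto simp: ebas_def act_ix_def gr_def Let_def)
    have im: "ebas (act_ix i v) \<in> vecs A_space" if "i \<in> M \<times> G" for i
      by (rule D(4)[OF act_ix_closed[OF that v]])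
    note * = the_linear_map_basis[OF has_basis_A_space D(1) im P]
    show ?thesis using *(1) *(4) by (simp add: A_bowtie_def)
  qed
  show ?thesis
    unfolding has_gbasis_def using B grad act by (simp add: lin)
qed

lemmas A_gbasis = has_gbasisD[OF has_gbasis_A_bowtie]

lemma ebas_in_A_space [simp]: "i \<in> M \<times> G \<Longrightarrow> ebas i \<in> vecs A_space"
  using A_gbasis(8) by simp

lemma has_gbasis_A_tensor:
  "has_gbasis (tensor A_bowtie A_bowtie) ((M \<times> G) \<times> (M \<times> G))
    (\<lambda>(i, j). ptens A_bowtie A_bowtie (ebas i) (ebas j)) (tensor_coord (\<lambda>f i. f i) (\<lambda>f i. f i))
    (\<lambda>(i, j). gr i \<odot> gr j) (\<lambda>(i, j) u. (act_ix i (gr j \<rhd> u), act_ix j u))"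
  by (rule has_gbasis_tensor[OF has_gbasis_A_bowtie has_gbasis_A_bowtie])

lemma act_A_tensor:
  assumes "i \<in> M \<times> G" "j \<in> M \<times> G" "u \<in> G"
  shows "act (tensor A_bowtie A_bowtie) (ptens A_bowtie A_bowtie (ebas i) (ebas j)) u =
    ptens A_bowtie A_bowtie (ebas (act_ix i (gr j \<rhd> u))) (ebas (act_ix j u))"
proof -
  have "(i, j) \<in> (M \<times> G) \<times> (M \<times> G)" using assms by blast
  from has_gbasisD(6)[OF has_gbasis_A_tensor this assms(3)] show ?thesis by (simp only: prod.case)
qed

lemma is_object_A_bowtie: "is_object A_bowtie"
  by (rule is_objectI[OF has_gbasis_A_bowtie])
    (auto simp: gr_act_ix mact_def act_ix_one act_ix_mult)

lemma A_mult_basis: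
  shows "linear_map (tensor_space A_bowtie A_bowtie) A_bowtie A_mult"
    and "A_mult \<in> extensional (vecs (tensor_space A_bowtie A_bowtie))"
    and "i \<in> M \<times> G \<Longrightarrow> j \<in> M \<times> G \<Longrightarrow> A_mult (ptens A_bowtie A_bowtie (ebas i) (ebas j)) =
      (if composable i j then ebas (mul_ix i j) else 0)"
proof -
  let ?P = "\<lambda>h. \<forall>s\<in>M. \<forall>u\<in>G. \<forall>t\<in>M. \<forall>v\<in>G. h (ptens A_bowtie A_bowtie (dlt s u) (dlt t v)) =
        (let g = tau (A_grade s u) (A_grade t v)
         in if t = s \<lhd>\<^sub>M u then dlt (s \<lhd>\<^sub>M g) (inv g \<otimes> u \<otimes> v) else 0)"
  let ?e = "\<lambda>(i, j). ptens A_bowtie A_bowtie (ebas i) (ebas j)"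
  let ?\<phi> = "\<lambda>(i, j). if composable i j then ebas (mul_ix i j) else 0"
  have P: "?P h \<longleftrightarrow> (\<forall>ij\<in>(M \<times> G) \<times> (M \<times> G). h (?e ij) = ?\<phi> ij)" for h
    by (auto simp: ebas_def mul_ix_def gr_def Let_def composable_def)
  have im: "?\<phi> ij \<in> vecs A_bowtie" if "ij \<in> (M \<times> G) \<times> (M \<times> G)" for ij
    using that A_gbasis(8)[OF mul_ix_closed] is_cspace_closed(1)[OF A_gbasis(7)] by auto
  have B: "has_basis (tensor A_bowtie A_bowtie) ((M \<times> G) \<times> (M \<times> G)) ?e (tensor_coord (\<lambda>f i. f i) (\<lambda>f i. f i))"
    by (rule has_gbasisD(1)[OF has_gbasis_A_tensor])
  note * = the_linear_map_basis[OF B A_gbasis(7) im P, folded A_mult_def]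
  show "linear_map (tensor_space A_bowtie A_bowtie) A_bowtie A_mult"
    and "A_mult \<in> extensional (vecs (tensor_space A_bowtie A_bowtie))"
    and "i \<in> M \<times> G \<Longrightarrow> j \<in> M \<times> G \<Longrightarrow> A_mult (ptens A_bowtie A_bowtie (ebas i) (ebas j)) =
      (if composable i j then ebas (mul_ix i j) else 0)"
    using *(1,2) *(4)[of "(i, j)"] by auto
qed

lemma A_star_basis:
  shows "linear_map A_bowtie (bar A_bowtie) A_star"
    and "A_star \<in> extensional (vecs A_bowtie)"
    and "i \<in> M \<times> G \<Longrightarrow> A_star (ebas i) = ebas (star_ix i)"
proof -
  let ?P = "\<lambda>h. \<forall>s\<in>M. \<forall>u\<in>G. h (dlt s u) =
        (let g = tau (A_grade s u) (rinv (A_grade s u))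
         in act A_bowtie (dlt (s \<lhd>\<^sub>M u) (inv u \<otimes> g)) (inv g))"
  \<comment> \<open>The star is defined through the action on the algebra, itself a linear
    extension; on a basis vector the action becomes \<open>act_ix\<close>.\<close>
  have "(let g = tau (gr i) (rinv (gr i))
         in act A_bowtie (ebas (fst i \<lhd>\<^sub>M snd i, inv (snd i) \<otimes> g)) (inv g)) = ebas (star_ix i)"
    if "i \<in> M \<times> G" for i
    using that by (simp add: star_ix_def A_gbasis(6) Let_def)
  then have P: "?P h \<longleftrightarrow> (\<forall>i\<in>M \<times> G. h (ebas i) = ebas (star_ix i))" for h
    by (force simp: dlt_eq_ebas gr_def)
  have im: "ebas (star_ix i) \<in> vecs (bar A_bowtie)" if "i \<in> M \<times> G" for i
    using A_gbasis(8)[OF star_ix_closed[OF that]] by simp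
  note * = the_linear_map_basis[OF A_gbasis(1) is_cspace_bar[OF A_gbasis(7)] im P, folded A_star_def]
  show "linear_map A_bowtie (bar A_bowtie) A_star"
    and "A_star \<in> extensional (vecs A_bowtie)"
    and "i \<in> M \<times> G \<Longrightarrow> A_star (ebas i) = ebas (star_ix i)"
    using *(1,2) *(4)[of i] by auto
qed

text \<open>Products of basis vectors may be 0, and these values are fed into further maps.\<close>

lemma A_mult_zero: "A_mult 0 = 0" and A_star_zero: "A_star 0 = 0"
  using linear_map_zero[OF is_cspace_tensor_space A_mult_basis(1)]
    linear_map_zero[OF A_gbasis(7) A_star_basis(1)] by auto

lemma ptens_zero:
  assumes "x \<in> vecs A_bowtie"
  shows "ptens A_bowtie A_bowtie 0 x = 0" "ptens A_bowtie A_bowtie x 0 = 0"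
  using linear_map_zero[OF A_gbasis(7) linear_map_ptens_left[OF assms]]
    linear_map_zero[OF A_gbasis(7) linear_map_ptens_right[OF assms]] by auto

lemma id_map_ebas: "i \<in> M \<times> G \<Longrightarrow> id_map A_bowtie (ebas i) = ebas i"
  using A_gbasis(8)[of i] by (simp add: id_map_def)

section \<open>Multiplication: morphism property and associativity\<close>

lemma A_mult_hom: "A_mult \<in> hom_set (tensor A_bowtie A_bowtie) A_bowtie"
proof (rule hom_setI[OF has_gbasis_A_tensor has_gbasis_A_bowtie])
  show "A_mult \<in> extensional (vecs (tensor A_bowtie A_bowtie))"
    "linear_map (tensor A_bowtie A_bowtie) A_bowtie A_mult"
    using A_mult_basis(1,2) by auto
next
  fix ij assume "ij \<in> (M \<times> G) \<times> (M \<times> G)"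
  then obtain i j where ij: "ij = (i, j)" "i \<in> M \<times> G" "j \<in> M \<times> G" by blast
  have "ebas (mul_ix i j) \<in> grad A_bowtie (gr i \<odot> gr j)" if "composable i j"
    using ij(2,3) gr_mul_ix[OF ij(2,3) that]
    by (intro grad_props(3)[OF has_gbasis_A_bowtie]) (simp_all add: mdot_def parts)
  \<comment> \<open>The case of a pair that is not composable: 0 lies in every component.\<close>
  moreover have "0 \<in> grad A_bowtie (gr i \<odot> gr j)"
    using ij(2,3) grad_props(1)[OF has_gbasis_A_bowtie, of "gr i \<odot> gr j"] A_gbasis(9)
    by (auto intro: module.subspace_0)
  ultimately show "A_mult (case ij of (i, j) \<Rightarrow> ptens A_bowtie A_bowtie (ebas i) (ebas j))
      \<in> grad A_bowtie (case ij of (i, j) \<Rightarrow> gr i \<odot> gr j)"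
    using ij by (simp add: A_mult_basis(3))
  fix u assume u: "u \<in> G"
  have "act A_bowtie 0 u = 0"
    using linear_map_zero[OF A_gbasis(7) A_gbasis(4)[OF u]] .
  then show "A_mult (case (case ij of (i, j) \<Rightarrow> \<lambda>u. (act_ix i (gr j \<rhd> u), act_ix j u)) u of
        (i, j) \<Rightarrow> ptens A_bowtie A_bowtie (ebas i) (ebas j)) =
      act A_bowtie (A_mult (case ij of (i, j) \<Rightarrow> ptens A_bowtie A_bowtie (ebas i) (ebas j))) u"
    using ij u composable_act_ix[OF ij(2,3) u] mul_ix_act_ix[OF ij(2,3) u]
    by (simp add: A_mult_basis(3) A_gbasis(6))
qed

lemma A_mult_assoc:
  "compose (vecs (tensor (tensor A_bowtie A_bowtie) A_bowtie)) A_mult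
      (tensor_map (tensor A_bowtie A_bowtie) A_bowtie A_bowtie A_bowtie A_mult (id_map A_bowtie)) =
   compose (vecs (tensor (tensor A_bowtie A_bowtie) A_bowtie)) A_mult
     (compose (vecs (tensor (tensor A_bowtie A_bowtie) A_bowtie))
       (tensor_map A_bowtie A_bowtie (tensor A_bowtie A_bowtie) A_bowtie (id_map A_bowtie) A_mult)
       (associator A_bowtie A_bowtie A_bowtie))"
proof -
  let ?A = "A_bowtie" and ?T = "tensor A_bowtie A_bowtie" and ?I = "M \<times> G"
  note T = has_gbasisD(1)[OF has_gbasis_A_tensor]
  have mult: "linear_map ?T ?A A_mult" using A_mult_basis(1) by simp
  note id = linear_map_id_map[OF A_gbasis(7)]
  note L = tensor_map_props[OF T A_gbasis(1) A_gbasis(7) A_gbasis(7) mult id]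
  note R = tensor_map_props[OF A_gbasis(1) T A_gbasis(7) A_gbasis(7) id mult]
  note S = associator_basis[OF has_gbasis_A_bowtie has_gbasis_A_bowtie has_gbasis_A_bowtie]
  note B = has_basis_tensor_space[OF T A_gbasis(1)]
  note C = is_cspace_tensor_space[of ?T ?A]
  have in3: "ptens ?T ?A (ptens ?A ?A (ebas i) (ebas j)) (ebas k) \<in> vecs (tensor_space ?T ?A)"
    if "i \<in> ?I" "j \<in> ?I" "k \<in> ?I" for i j k
    using that A_gbasis(8) by (simp add: ptens_in_tensor_space)
  have "compose (vecs (tensor_space ?T ?A)) A_mult (tensor_map ?T ?A ?A ?A A_mult (id_map ?A)) =
   compose (vecs (tensor_space ?T ?A)) A_mult
     (compose (vecs (tensor_space ?T ?A)) (tensor_map ?A ?A ?T ?A (id_map ?A) A_mult) (associator ?A ?A ?A))"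
  proof (rule extensional_linear_map_eqI[OF B])
    show "linear_map (tensor_space ?T ?A) ?A
        (compose (vecs (tensor_space ?T ?A)) A_mult (tensor_map ?T ?A ?A ?A A_mult (id_map ?A)))"
      by (rule linear_map_compose[OF C L(1) A_mult_basis(1)])
    show "linear_map (tensor_space ?T ?A) ?A (compose (vecs (tensor_space ?T ?A)) A_mult
        (compose (vecs (tensor_space ?T ?A)) (tensor_map ?A ?A ?T ?A (id_map ?A) A_mult) (associator ?A ?A ?A)))"
      by (rule linear_map_compose[OF C linear_map_compose[OF C S(1) R(1)] A_mult_basis(1)])
    fix ijk assume "ijk \<in> (?I \<times> ?I) \<times> ?I"
    then obtain i j k where ijk: "ijk = ((i, j), k)" and i: "i \<in> ?I" and j: "j \<in> ?I" and k: "k \<in> ?I"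
      by (metis SigmaE)
    have TT: "ptens ?A ?A (ebas i) (ebas j) \<in> vecs ?T" if "i \<in> ?I" "j \<in> ?I" for i j
      using that A_gbasis(8) by (simp add: ptens_in_tensor_space)
    have left: "A_mult (tensor_map ?T ?A ?A ?A A_mult (id_map ?A)
        (ptens ?T ?A (ptens ?A ?A (ebas i) (ebas j)) (ebas k))) =
      (if composable i j \<and> composable (mul_ix i j) k then ebas (mul_ix (mul_ix i j) k) else 0)"
      using i j k TT[OF i j] A_gbasis(8)[OF k]
      by (simp add: L(3) A_mult_basis(3) id_map_ebas ptens_zero A_mult_zero)
    \<comment> \<open>The associator moves the first factor by \<open>tau (gr j) (gr k)\<close>
      before the other bracketing is formed.\<close>
    let ?i = "act_ix i (tau (gr j) (gr k))"
    have i': "?i \<in> ?I" using i j k by simp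
    have right: "A_mult (tensor_map ?A ?A ?T ?A (id_map ?A) A_mult (associator ?A ?A ?A
        (ptens ?T ?A (ptens ?A ?A (ebas i) (ebas j)) (ebas k)))) =
      (if composable j k \<and> composable ?i (mul_ix j k) then ebas (mul_ix ?i (mul_ix j k)) else 0)"
      using i j k i' TT[OF j k] A_gbasis(8)[OF i']
      by (simp add: S(3) R(3) A_mult_basis(3) id_map_ebas ptens_zero A_mult_zero)
    show "compose (vecs (tensor_space ?T ?A)) A_mult (tensor_map ?T ?A ?A ?A A_mult (id_map ?A))
        (case ijk of (ij, k) \<Rightarrow> ptens ?T ?A (case ij of (i, j) \<Rightarrow> ptens ?A ?A (ebas i) (ebas j)) (ebas k)) =
      compose (vecs (tensor_space ?T ?A)) A_mult
       (compose (vecs (tensor_space ?T ?A)) (tensor_map ?A ?A ?T ?A (id_map ?A) A_mult) (associator ?A ?A ?A))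
        (case ijk of (ij, k) \<Rightarrow> ptens ?T ?A (case ij of (i, j) \<Rightarrow> ptens ?A ?A (ebas i) (ebas j)) (ebas k))"
      unfolding ijk prod.case compose_eq[OF in3[OF i j k]] left right
      using composable_assoc[OF i j k] mul_ix_assoc[OF i j k] by (intro if_cong) simp_all
  qed simp_all
  then show ?thesis by simp
qed


section \<open>The unit\<close>

lemma A_unit_eq: "A_unit z = fun_scale z (\<Sum>t\<in>M. ebas (t, \<one>))"
  by (simp add: A_unit_def dlt_eq_ebas)

lemma A_unit_one: "A_unit 1 = (\<Sum>t\<in>M. ebas (t, \<one>))"
  by (simp add: A_unit_eq fun_scale_def)

lemma A_unit_in: "(\<Sum>t\<in>M. ebas (t, \<one>)) \<in> vecs A_bowtie"
  by (intro is_cspace_closed(4)[OF A_gbasis(7)] A_gbasis(8)) simp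

lemma linear_map_A_unit: "linear_map unit_object A_bowtie A_unit"
proof -
  interpret vector_space fun_scale by (rule vector_space_fun_scale)
  show ?thesis
    using is_cspace_closed(3)[OF A_gbasis(7) A_unit_in]
    by (intro linear_mapI) (auto simp: A_unit_eq scale_left_distrib)
qed

lemma A_unit_hom: "A_unit \<in> hom_set unit_object A_bowtie"
proof (rule hom_setI[OF has_gbasis_unit has_gbasis_A_bowtie])
  interpret module fun_scale by (rule module_fun_scale)
  show "linear_map unit_object A_bowtie A_unit" by (rule linear_map_A_unit)
  show "A_unit 1 \<in> grad A_bowtie \<one>"
    unfolding A_unit_one
    using grad_props(1,3)[OF has_gbasis_A_bowtie one_in_M]
    by (intro subspace_sum) (auto simp: gr_unit)
  fix u assume u: "u \<in> G"
  have "act A_bowtie (A_unit 1) u = (\<Sum>t\<in>M. act A_bowtie (ebas (t, \<one>)) u)"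
    unfolding A_unit_one
    by (rule linear_map_sum[OF A_gbasis(7) A_gbasis(4)[OF u]]) (simp add: A_gbasis(8))
  also have "\<dots> = (\<Sum>t\<in>M. ebas (mpart (t \<otimes> u), \<one>))"
    using u by (intro sum.cong) (simp_all add: A_gbasis(6) act_ix_unit)
  \<comment> \<open>The action of \<open>u\<close> permutes the summands of the unit, and that of
    \<open>inv u\<close> undoes it.\<close>
  also have "\<dots> = (\<Sum>t\<in>M. ebas (t, \<one>))"
    by (rule sum.reindex_bij_witness[of _ "\<lambda>t. mpart (t \<otimes> inv u)" "\<lambda>t. mpart (t \<otimes> u)"])
      (use u in \<open>auto simp: parts m_assoc\<close>)
  finally show "A_unit 1 = act A_bowtie (A_unit 1) u" by (simp add: A_unit_one)
qed simp

lemma A_left_unit: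
  "compose (vecs (tensor unit_object A_bowtie)) A_mult
     (tensor_map unit_object A_bowtie A_bowtie A_bowtie A_unit (id_map A_bowtie)) = left_unitor A_bowtie"
proof -
  let ?A = "A_bowtie" and ?U = "unit_object :: ('x, complex) gspace"
  note U = has_gbasisD[OF has_gbasis_unit]
  note L = tensor_map_props[OF U(1) A_gbasis(1) A_gbasis(7) A_gbasis(7) linear_map_A_unit
      linear_map_id_map[OF A_gbasis(7)]]
  note S = left_unitor_basis[OF A_gbasis(1)]
  have "compose (vecs (tensor_space ?U ?A)) A_mult (tensor_map ?U ?A ?A ?A A_unit (id_map ?A)) = left_unitor ?A"
  proof (rule extensional_linear_map_eqI[OF has_basis_tensor_space[OF U(1) A_gbasis(1)] _ S(1)])
    show "linear_map (tensor_space ?U ?A) ?A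
        (compose (vecs (tensor_space ?U ?A)) A_mult (tensor_map ?U ?A ?A ?A A_unit (id_map ?A)))"
      by (rule linear_map_compose[OF is_cspace_tensor_space L(1) A_mult_basis(1)])
    fix ij assume "ij \<in> {()} \<times> (M \<times> G)"
    then obtain i where ij: "ij = ((), i)" and i: "i \<in> M \<times> G" by auto
    have "A_mult (tensor_map ?U ?A ?A ?A A_unit (id_map ?A) (ptens ?U ?A 1 (ebas i))) =
      A_mult (ptens ?A ?A (\<Sum>t\<in>M. ebas (t, \<one>)) (ebas i))"
      using i A_gbasis(8)[OF i] by (simp add: L(3) id_map_ebas A_unit_one)
    also have "\<dots> = (\<Sum>t\<in>M. A_mult (ptens ?A ?A (ebas (t, \<one>)) (ebas i)))"
      by (rule linear_map_sum[OF A_gbasis(7) linear_map_comp[OF linear_map_ptens_left[OF A_gbasis(8)[OF i]]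
              A_mult_basis(1)]]) (simp add: A_gbasis(8))
    also have "\<dots> = (\<Sum>t\<in>M. if t = fst i then ebas i else 0)"
      using i by (intro sum.cong) (auto simp: A_mult_basis(3) mul_ix_unit)
    also have "\<dots> = ebas i"
      using i finite_MG(1) by simp
    finally show "compose (vecs (tensor_space ?U ?A)) A_mult (tensor_map ?U ?A ?A ?A A_unit (id_map ?A))
        (case ij of (j, i) \<Rightarrow> ptens ?U ?A 1 (ebas i)) =
      left_unitor ?A (case ij of (j, i) \<Rightarrow> ptens ?U ?A 1 (ebas i))"
      using i A_gbasis(8)[OF i] by (simp add: ij compose_eq S(3) ptens_in_tensor_space)
  qed (simp_all add: S(2))
  then show ?thesis by simp
qed

lemma A_right_unit:
  "compose (vecs (tensor A_bowtie unit_object)) A_mult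
     (tensor_map A_bowtie A_bowtie unit_object A_bowtie (id_map A_bowtie) A_unit) = right_unitor A_bowtie"
proof -
  let ?A = "A_bowtie" and ?U = "unit_object :: ('x, complex) gspace"
  note U = has_gbasisD[OF has_gbasis_unit]
  note L = tensor_map_props[OF A_gbasis(1) U(1) A_gbasis(7) A_gbasis(7) linear_map_id_map[OF A_gbasis(7)]
      linear_map_A_unit]
  note S = right_unitor_basis[OF A_gbasis(1)]
  have "compose (vecs (tensor_space ?A ?U)) A_mult (tensor_map ?A ?A ?U ?A (id_map ?A) A_unit) = right_unitor ?A"
  proof (rule extensional_linear_map_eqI[OF has_basis_tensor_space[OF A_gbasis(1) U(1)] _ S(1)])
    show "linear_map (tensor_space ?A ?U) ?A
        (compose (vecs (tensor_space ?A ?U)) A_mult (tensor_map ?A ?A ?U ?A (id_map ?A) A_unit))"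
      by (rule linear_map_compose[OF is_cspace_tensor_space L(1) A_mult_basis(1)])
    fix ij assume "ij \<in> (M \<times> G) \<times> {()}"
    then obtain i where ij: "ij = (i, ())" and i: "i \<in> M \<times> G" by auto
    have "A_mult (tensor_map ?A ?A ?U ?A (id_map ?A) A_unit (ptens ?A ?U (ebas i) 1)) =
      A_mult (ptens ?A ?A (ebas i) (\<Sum>t\<in>M. ebas (t, \<one>)))"
      using i A_gbasis(8)[OF i] by (simp add: L(3) id_map_ebas A_unit_one)
    also have "\<dots> = (\<Sum>t\<in>M. A_mult (ptens ?A ?A (ebas i) (ebas (t, \<one>))))"
      by (rule linear_map_sum[OF A_gbasis(7) linear_map_comp[OF linear_map_ptens_right[OF A_gbasis(8)[OF i]]
              A_mult_basis(1)]]) (simp add: A_gbasis(8))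
    \<comment> \<open>On the right the surviving summand sits at the end of \<open>i\<close>, on the
      left it sat at the start.\<close>
    also have "\<dots> = (\<Sum>t\<in>M. if t = mpart (fst i \<otimes> snd i) then ebas i else 0)"
      using i by (intro sum.cong) (auto simp: A_mult_basis(3) mul_ix_unit)
    also have "\<dots> = ebas i"
      using i finite_MG(1) parts(2)[of "fst i \<otimes> snd i"] by simp
    finally show "compose (vecs (tensor_space ?A ?U)) A_mult (tensor_map ?A ?A ?U ?A (id_map ?A) A_unit)
        (case ij of (i, j) \<Rightarrow> ptens ?A ?U (ebas i) 1) =
      right_unitor ?A (case ij of (i, j) \<Rightarrow> ptens ?A ?U (ebas i) 1)"
      using i A_gbasis(8)[OF i] by (simp add: ij compose_eq S(3) ptens_in_tensor_space)
  qed (simp_all add: S(2))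
  then show ?thesis by simp
qed

section \<open>The star axioms\<close>

lemma A_star_hom: "A_star \<in> hom_set A_bowtie (bar A_bowtie)"
proof (rule hom_setI[OF has_gbasis_A_bowtie has_gbasis_bar[OF has_gbasis_A_bowtie]])
  fix i assume i: "i \<in> M \<times> G"
  note bar = has_gbasis_bar[OF has_gbasis_A_bowtie]
  \<comment> \<open>Grades in the conjugate are right inverses, and \<open>star_ix i\<close> has the
    left inverse of \<open>gr i\<close> as its grade; the two inversions cancel, so the star
    preserves grades.\<close>
  have gr: "rinv (gr (star_ix i)) = gr i"
    using i by (simp add: star_ix_eq(3) linv_eq[symmetric])
  show "A_star (ebas i) \<in> grad (bar A_bowtie) (gr i)"
    unfolding A_star_basis(3)[OF i]
    by (rule grad_props(3)[OF bar ix_closed(3)[OF i] star_ix_closed[OF i] gr])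
  show "A_star (ebas (act_ix i u)) = act (bar A_bowtie) (A_star (ebas i)) u" if u: "u \<in> G" for u
    using i u has_gbasisD(6)[OF bar star_ix_closed[OF i] u]
    by (simp add: A_star_basis(3) gr star_ix_act_ix)
qed (use A_star_basis(1,2) in simp_all)

lemma A_star_star: "compose (vecs A_bowtie) (bar_map A_star) A_star = bb A_bowtie"
proof -
  note S = bb_basis[OF has_gbasis_A_bowtie]
  show ?thesis
  proof (rule extensional_linear_map_eqI[OF A_gbasis(1) _ S(1)])
    show "linear_map A_bowtie (bar (bar A_bowtie)) (compose (vecs A_bowtie) (bar_map A_star) A_star)"
      unfolding bar_map_def
      by (rule linear_map_compose[OF A_gbasis(7) A_star_basis(1)]) (simp add: A_star_basis(1))
    show "compose (vecs A_bowtie) (bar_map A_star) A_star (ebas i) = bb A_bowtie (ebas i)"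
      if i: "i \<in> M \<times> G" for i
      using i A_gbasis(8)[OF i]
      by (simp add: compose_eq bar_map_def A_star_basis(3) S(3) star_ix_star_ix)
  qed (use S(2) in simp_all)
qed

lemma A_star_mult:
  "compose (vecs (tensor A_bowtie A_bowtie)) (bar_map A_mult)
     (compose (vecs (tensor A_bowtie A_bowtie)) (upsilon_inv A_bowtie A_bowtie)
       (tensor_map A_bowtie (bar A_bowtie) A_bowtie (bar A_bowtie) A_star A_star)) =
   compose (vecs (tensor A_bowtie A_bowtie)) A_star A_mult"
proof -
  let ?A = "A_bowtie" and ?B = "bar A_bowtie" and ?S = "tensor_space A_bowtie A_bowtie"
  note C = is_cspace_bar[OF A_gbasis(7)]
  note L = tensor_map_props[OF A_gbasis(1) A_gbasis(1) C C A_star_basis(1) A_star_basis(1)]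
  note Y = upsilon_inv_basis[OF has_gbasis_A_bowtie has_gbasis_A_bowtie]
  have "compose (vecs ?S) A_mult (compose (vecs ?S) (upsilon_inv ?A ?A) (tensor_map ?A ?B ?A ?B A_star A_star)) =
   compose (vecs ?S) A_star A_mult"
  proof (rule extensional_linear_map_eqI[OF has_basis_tensor_space[OF A_gbasis(1) A_gbasis(1)]])
    have "linear_map (bar (tensor ?A ?A)) ?B A_mult" using A_mult_basis(1) by simp
    then show "linear_map ?S ?B (compose (vecs ?S) A_mult
        (compose (vecs ?S) (upsilon_inv ?A ?A) (tensor_map ?A ?B ?A ?B A_star A_star)))"
      by (rule linear_map_compose[OF is_cspace_tensor_space linear_map_compose[OF is_cspace_tensor_space L(1) Y(1)]])
    show "linear_map ?S ?B (compose (vecs ?S) A_star A_mult)"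
      by (rule linear_map_compose[OF is_cspace_tensor_space A_mult_basis(1) A_star_basis(1)])
    fix ij assume "ij \<in> (M \<times> G) \<times> (M \<times> G)"
    then obtain i j where ij: "ij = (i, j)" and i: "i \<in> M \<times> G" and j: "j \<in> M \<times> G" by blast
    define a where "a = gr i"
    define b where "b = gr j"
    \<comment> \<open>The inverse of \<Upsilon> swaps the factors and acts on the one that was
      second by \<open>inv (tau p (rinv p))\<close>, where \<open>p = linv a\<close> is the grade of
      \<open>star_ix i\<close> and \<open>rinv p = a\<close>.\<close>
    define k where "k = act_ix (star_ix j) (inv (tau (linv a) a))"
    have ab: "a \<in> M" "b \<in> M" using i j by (simp_all add: a_def b_def)
    have gr: "gr (star_ix i) = linv a" "gr (star_ix j) = linv b"
      using i j by (simp_all add: star_ix_eq a_def b_def linv_eq)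
    have k: "k \<in> M \<times> G" using j ab by (simp add: k_def)
    have 1: "tensor_map ?A ?B ?A ?B A_star A_star (ptens ?A ?A (ebas i) (ebas j)) =
        ptens ?B ?B (ebas (star_ix i)) (ebas (star_ix j))"
      using i j A_gbasis(8) by (simp add: L(3) A_star_basis(3))
    have "upsilon_inv ?A ?A (ptens ?B ?B (ebas (star_ix i)) (ebas (star_ix j))) =
        act (tensor ?A ?A) (ptens ?A ?A (ebas k) (ebas (star_ix i))) (tau a b)"
      using i j ab by (simp add: Y(3) gr k_def)
    also have "\<dots> = ptens ?A ?A (ebas (act_ix k (gr (star_ix i) \<rhd> tau a b)))
        (ebas (act_ix (star_ix i) (tau a b)))"
      by (rule act_A_tensor[OF k star_ix_closed[OF i] operations_closed(1)[OF ab]])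
    finally have 2: "upsilon_inv ?A ?A (ptens ?B ?B (ebas (star_ix i)) (ebas (star_ix j))) =
      ptens ?A ?A (ebas (act_ix k (gr (star_ix i) \<rhd> tau a b))) (ebas (act_ix (star_ix i) (tau a b)))" .
    \<comment> \<open>The action by \<open>tau a b\<close> commutes with the product and preserves
      composability, so it can be pulled out before the index identities for the star apply.\<close>
    have "A_mult (ptens ?A ?A (ebas (act_ix k (gr (star_ix i) \<rhd> tau a b)))
          (ebas (act_ix (star_ix i) (tau a b)))) =
        (if composable k (star_ix i) then ebas (act_ix (mul_ix k (star_ix i)) (tau a b)) else 0)"
      using i k ab composable_act_ix[OF k star_ix_closed[OF i] operations_closed(1)[OF ab]]
        mul_ix_act_ix[OF k star_ix_closed[OF i] operations_closed(1)[OF ab]]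
      by (simp add: A_mult_basis(3))
    also have "\<dots> = (if composable i j then ebas (star_ix (mul_ix i j)) else 0)"
      using composable_star_ix[OF i j] star_ix_mul_ix[OF i j] by (simp add: k_def a_def b_def)
    also have "\<dots> = A_star (A_mult (ptens ?A ?A (ebas i) (ebas j)))"
      using i j by (simp add: A_mult_basis(3) A_star_basis(3) A_star_zero)
    finally show "compose (vecs ?S) A_mult
        (compose (vecs ?S) (upsilon_inv ?A ?A) (tensor_map ?A ?B ?A ?B A_star A_star))
        (case ij of (i, j) \<Rightarrow> ptens ?A ?A (ebas i) (ebas j)) =
      compose (vecs ?S) A_star A_mult (case ij of (i, j) \<Rightarrow> ptens ?A ?A (ebas i) (ebas j))"
      using i j A_gbasis(8) by (simp add: ij compose_eq ptens_in_tensor_space 1 2)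
  qed simp_all
  then show ?thesis by (simp add: bar_map_def)
qed

text \<open>Each \<open>(t, \<one>)\<close> is fixed by the involution, hence so is the unit vector.
  The conjugated scalars of \<open>bar\<close> supply the complex conjugate demanded by
  \<open>unit_star\<close>.\<close>

lemma A_star_unit:
  "compose (vecs unit_object) (bar_map A_unit) unit_star = compose (vecs unit_object) A_star A_unit"
proof -
  have "A_star (\<Sum>t\<in>M. ebas (t, \<one>)) = (\<Sum>t\<in>M. ebas (t, \<one>))"
    by (subst linear_map_sum[OF A_gbasis(7) A_star_basis(1)])
      (auto simp: A_gbasis(8) A_star_basis(3) star_ix_unit intro!: sum.cong)
  then have "A_star (A_unit z) = A_unit (cnj z)" for z
    using linear_mapD(3)[OF A_star_basis(1) A_unit_in, of z] by (simp add: A_unit_eq)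
  then show ?thesis
    by (simp add: compose_def bar_map_def unit_star_def)
qed

theorem is_star_algebra_A_bowtie: "is_star_algebra A_bowtie A_mult A_unit A_star"
  unfolding is_star_algebra_def is_algebra_def
  by (intro conjI is_object_A_bowtie A_mult_hom A_unit_hom A_mult_assoc A_left_unit A_right_unit
      A_star_hom A_star_star A_star_mult A_star_unit)

end

theorem proposition5p11:
  fixes X :: "('x, 'k) monoid_scheme" (structure)
    and G M :: "'x set"
  assumes "group X" and "finite (carrier X)"
    and "subgroup G X"
    and "M \<subseteq> carrier X" and "\<one> \<in> M"
    and "\<forall>x\<in>carrier X. \<exists>!(u, s). u \<in> G \<and> s \<in> M \<and> x = u \<otimes> s"
    and "\<forall>t\<in>M. \<exists>!r. r \<in> M \<and> coset_data.mdot X G M t r = \<one>"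
    and "\<forall>s\<in>M. \<forall>u\<in>G. \<exists>!a. a \<in> M \<and> coset_data.mdot X G M s a = coset_data.mact X G M s u"
  shows "coset_data.is_star_algebra X G M
           (coset_data.A_bowtie X G M) (coset_data.A_mult X G M)
           (coset_data.A_unit X G M) (coset_data.A_star X G M)"
proof -
  interpret coset_system X G M
    using assms by (intro coset_system.intro coset_system_axioms.intro)
  show ?thesis by (rule is_star_algebra_A_bowtie)
qed

end
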